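(* Let $\mathcal T$ be a balanced staged tree with leaves numbered $1,\dots,n$ from top to bottom. Let $G\subset\mathbb R[p_1,\dots,p_n]$ be the set consisting of (a) all binomials $p_r-p_s$ of degree one contained in $\ker\varphi_{\mathcal T}$, and (b) all binomials $p_{r_1}p_{r_2}-p_{s_1}p_{s_2}\in\ker\varphi_{\mathcal T}$ for which there are vertices $u,v$ of $\mathcal T$ in the same stage and indices $i,j$ such that the path $\lambda_{r_1}$ goes through $u_i$, the path $\lambda_{r_2}$ goes through $v_j$, the path $\lambda_{s_1}$ goes through $u_j$, and the path $\lambda_{s_2}$ goes through $v_i$. Then $G$ is a Gröbner basis of the ideal $\ker\varphi_{\mathcal T}$ with respect to the degree reverse lexicographic order with $p_1\succ p_2\succ\dots\succ p_n$.
   Context: A staged tree $\mathcal T$ is a finite rooted tree, edges directed away from the root, with an equivalence relation $\sim$ on vertices (classes are called stages or colours) and edge labels $\theta(e)$ such that: the outgoing edges of an inner vertex have pairwise distinct labels; inner vertices in the same stage have the same set of outgoing edge labels; inner vertices in different stages have disjoint sets of outgoing labels; leaves are (by convention) all in the same stage. Labels stand for probabilities in $(0,1)$ summing to one at each inner vertex, so each inner vertex has at least two children. The children of a vertex $v$ are written $v_1,\dots,v_k$ (listed from top to bottom in the drawing of the tree); the order is such that if $u\sim v$ is a stage with labels $\theta_1,\dots,\theta_k$, then the edges $(u,u_i)$ and $(v,v_i)$ both have label $\theta_i$. The leaves $1,\dots,n$ are numbered from top to bottom in this plane drawing. $\lambda_r$ is the root-to-leaf path ending in leaf $r$, $E(\lambda_r)$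 its set of edges, $d(\lambda_r)=|E(\lambda_r)|$, and $d=\max_r d(\lambda_r)$. Treat the set $\Theta$ of labels as variables, let $z$ be one extra variable, and let $\langle\theta-z\rangle\subset\mathbb R[\Theta,z]$ be the ideal generated by $\sum_{e\in E(v)}\theta(e)-z$ for all inner vertices $v$, where $E(v)$ is the set of outgoing edges of $v$. Define the $\mathbb R$-algebra map $$\varphi_{\mathcal T}:\mathbb R[p_1,\dots,p_n]\to\mathbb R[\Theta,z]/\langle\theta-z\rangle,\qquad p_r\mapsto z^{d-d(\lambda_r)}\prod_{e\in E(\lambda_r)}\theta(e).$$ For a vertex $v$, $t(v)\in\mathbb R[\Theta]$ is the sum over all $v$-to-leaf paths of the product of the labels along the path ($t(v)=1$ for a leaf). $\mathcal T$ is balanced if for any two vertices $u\sim v$ in the same stage, $t(u_i)t(v_j)=t(u_j)t(v_i)$ in $\mathbb R[\Theta]$ for all $i,j=1,\dots,k$. It is known that for balanced $\mathcal T$ the ideal $\ker\varphi_{\mathcal T}$ equals the kernel of the monomial map $\mathbb R[p_1,\dots,p_n]\to\mathbb R[\Theta,z]$ given by the same formula. Degree reverse lexicographic order: $p^\alpha\succ p^\beta$ if $\sum\alpha_i>\sum\beta_i$, or $\sum\alpha_i=\sum\beta_i$ and there is an $i$ with $\alpha_i<\beta_i$ and $\alpha_j=\beta_j$ for all $j>i$.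
   Formalization: The tree is assumed to have at least one edge: for the one-vertex tree the map sends p_1 to 1, so the kernel is generated by p_1 - 1 while G has no nonzero element, and the claim fails. *)

theory Defs
  imports
    Complex_Main
    "HOL-Algebra.QuotRing"
    "HOL-Library.Poly_Mapping"
    "HOL-Library.List_Lexorder"
    "HOL-Library.Sublist"
begin

section \<open>Polynomial rings\<close>

text \<open>Real polynomials in variables of type \<open>'x\<close>; exponent vectors are finitely supported maps
  \<open>'x \<Rightarrow>\<^sub>0 nat\<close>.\<close>

type_synonym 'x mpoly = "('x \<Rightarrow>\<^sub>0 nat) \<Rightarrow>\<^sub>0 real"

definition poly_ring :: "'x set \<Rightarrow> 'x mpoly ring" where
  "poly_ring X =
    \<lparr>carrier = {f. \<forall>m\<in>Poly_Mapping.keys f. Poly_Mapping.keys m \<subseteq> X},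
     mult = (*), one = 1, zero = 0, add = (+)\<rparr>"

definition mvar :: "'x \<Rightarrow> 'x mpoly" where
  "mvar x = Poly_Mapping.single (Poly_Mapping.single x 1) 1"

text \<open>The \<open>\<real>\<close>-algebra map sending the variable \<open>x\<close> to \<open>s x\<close>.\<close>

definition poly_subst :: "('x \<Rightarrow> 'y mpoly) \<Rightarrow> 'x mpoly \<Rightarrow> 'y mpoly" where
  "poly_subst s f =
    (\<Sum>m\<in>Poly_Mapping.keys f. Poly_Mapping.single 0 (Poly_Mapping.lookup f m) *
       (\<Prod>x\<in>Poly_Mapping.keys m. s x ^ Poly_Mapping.lookup m x))"


section \<open>Monomial orders and Groebner bases\<close>

definition total_degree :: "('x \<Rightarrow>\<^sub>0 nat) \<Rightarrow> nat" where
  "total_degree a = (\<Sum>x\<in>Poly_Mapping.keys a. Poly_Mapping.lookup a x)"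

text \<open>\<open>degrevlex_gt a b\<close> means \<open>p^a \<succ> p^b\<close>; smaller indices are larger variables.\<close>

definition degrevlex_gt :: "(nat \<Rightarrow>\<^sub>0 nat) \<Rightarrow> (nat \<Rightarrow>\<^sub>0 nat) \<Rightarrow> bool" where
  "degrevlex_gt a b \<longleftrightarrow>
    total_degree a > total_degree b \<or>
    total_degree a = total_degree b \<and>
      (\<exists>i. Poly_Mapping.lookup a i < Poly_Mapping.lookup b i \<and>
           (\<forall>j>i. Poly_Mapping.lookup a j = Poly_Mapping.lookup b j))"

text \<open>Leading exponent and leading term with respect to the strict order \<open>gt\<close>; only meaningful for
  nonzero \<open>f\<close>.\<close>

definition lead_exp :: "(('x \<Rightarrow>\<^sub>0 nat) \<Rightarrow> ('x \<Rightarrow>\<^sub>0 nat) \<Rightarrow> bool) \<Rightarrow> 'x mpoly \<Rightarrow> ('x \<Rightarrow>\<^sub>0 nat)" where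
  "lead_exp gt f =
    (THE m. m \<in> Poly_Mapping.keys f \<and> (\<forall>m'\<in>Poly_Mapping.keys f. m' \<noteq> m \<longrightarrow> gt m m'))"

definition lead_term :: "(('x \<Rightarrow>\<^sub>0 nat) \<Rightarrow> ('x \<Rightarrow>\<^sub>0 nat) \<Rightarrow> bool) \<Rightarrow> 'x mpoly \<Rightarrow> 'x mpoly" where
  "lead_term gt f = Poly_Mapping.single (lead_exp gt f) (Poly_Mapping.lookup f (lead_exp gt f))"

definition initial_ideal ::
  "'x set \<Rightarrow> (('x \<Rightarrow>\<^sub>0 nat) \<Rightarrow> ('x \<Rightarrow>\<^sub>0 nat) \<Rightarrow> bool) \<Rightarrow> 'x mpoly set \<Rightarrow> 'x mpoly set" where
  "initial_ideal X gt F = Idl\<^bsub>poly_ring X\<^esub> (lead_term gt ` (F - {0}))"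

definition is_groebner_basis ::
  "'x set \<Rightarrow> (('x \<Rightarrow>\<^sub>0 nat) \<Rightarrow> ('x \<Rightarrow>\<^sub>0 nat) \<Rightarrow> bool) \<Rightarrow> 'x mpoly set \<Rightarrow> 'x mpoly set \<Rightarrow> bool" where
  "is_groebner_basis X gt I G \<longleftrightarrow>
    finite G \<and> G \<subseteq> I \<and> initial_ideal X gt G = initial_ideal X gt I"


section \<open>Staged trees\<close>

text \<open>A finite rooted plane tree is given by addresses: the root is \<open>[]\<close> and the children of \<open>v\<close>,
  listed from top to bottom, are \<open>v @ [0], v @ [1], \<dots>\<close>. An edge is the pair of its end points.\<close>

type_synonym vertex = "nat list"

record 'l plane_tree =
  verts :: "vertex set"
  label :: "vertex \<times> vertex \<Rightarrow> 'l"
  stage :: "(vertex \<times> vertex) set"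

definition out_edges :: "'l plane_tree \<Rightarrow> vertex \<Rightarrow> (vertex \<times> vertex) set" where
  "out_edges T v = {(v, v @ [i]) |i. v @ [i] \<in> verts T}"

definition inner :: "'l plane_tree \<Rightarrow> vertex set" where
  "inner T = {v \<in> verts T. out_edges T v \<noteq> {}}"

definition leaves :: "'l plane_tree \<Rightarrow> vertex set" where
  "leaves T = verts T - inner T"

definition labels :: "'l plane_tree \<Rightarrow> 'l set" where
  "labels T = (\<Union>v\<in>verts T. label T ` out_edges T v)"

text \<open>Since leaves have no outgoing labels, \<open>stage_labels\<close> also says that no leaf shares a stage
  with an inner vertex. The one-vertex tree is admitted here; for it the kernel of \<open>phi\<close> below is
  \<open>\<langle>p\<^sub>1 - 1\<rangle>\<close>, which is not homogeneous.\<close>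

locale staged_tree =
  fixes T :: "'l plane_tree"
  assumes finite_verts: "finite (verts T)"
    and root: "[] \<in> verts T"
    and parent: "v @ [i] \<in> verts T \<Longrightarrow> v \<in> verts T"
    and sibling: "v @ [Suc i] \<in> verts T \<Longrightarrow> v @ [i] \<in> verts T"
    and two_children: "v \<in> inner T \<Longrightarrow> card (out_edges T v) \<ge> 2"
    and labels_distinct: "v \<in> inner T \<Longrightarrow> inj_on (label T) (out_edges T v)"
    and stage_equiv: "equiv (verts T) (stage T)"
    and stage_labels: "(u, v) \<in> stage T \<Longrightarrow> label T ` out_edges T u = label T ` out_edges T v"
    and stage_disjoint: "\<lbrakk>u \<in> inner T; v \<in> inner T; (u, v) \<notin> stage T\<rbrakk> \<Longrightarrow>
      label T ` out_edges T u \<inter> label T ` out_edges T v = {}"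
    and stage_leaves: "\<lbrakk>u \<in> leaves T; v \<in> leaves T\<rbrakk> \<Longrightarrow> (u, v) \<in> stage T"
    and stage_order: "\<lbrakk>(u, v) \<in> stage T; u @ [i] \<in> verts T\<rbrakk> \<Longrightarrow>
      v @ [i] \<in> verts T \<and> label T (u, u @ [i]) = label T (v, v @ [i])"

text \<open>The edges of the path from \<open>v\<close> down to its descendant \<open>w\<close>.\<close>

definition path_edges :: "vertex \<Rightarrow> vertex \<Rightarrow> (vertex \<times> vertex) set" where
  "path_edges v w = {(take k w, take (Suc k) w) |k. length v \<le> k \<and> k < length w}"

text \<open>The polynomial \<open>t(v)\<close>.\<close>

definition subtree_poly :: "'l plane_tree \<Rightarrow> vertex \<Rightarrow> 'l mpoly" where
  "subtree_poly T v =
    (\<Sum>w\<in>{w \<in> leaves T. prefix v w}. \<Prod>e\<in>path_edges v w. mvar (label T e))"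

definition balanced :: "'l plane_tree \<Rightarrow> bool" where
  "balanced T \<longleftrightarrow>
    (\<forall>(u, v)\<in>stage T. \<forall>i j. u @ [i] \<in> verts T \<and> u @ [j] \<in> verts T \<longrightarrow>
      subtree_poly T (u @ [i]) * subtree_poly T (v @ [j]) =
      subtree_poly T (u @ [j]) * subtree_poly T (v @ [i]))"

definition num_leaves :: "'l plane_tree \<Rightarrow> nat" where
  "num_leaves T = card (leaves T)"

text \<open>Leaf number \<open>r \<in> {1..n}\<close>: going from top to bottom in the drawing is the lexicographic order of
  addresses. The path \<open>\<lambda>\<^sub>r\<close> is identified with its end point; it goes through the vertex \<open>w\<close>
  iff \<open>prefix w (leaf T r)\<close>.\<close>

definition leaf :: "'l plane_tree \<Rightarrow> nat \<Rightarrow> vertex" where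
  "leaf T r = sorted_list_of_set (leaves T) ! (r - 1)"

definition leaf_depth :: "'l plane_tree \<Rightarrow> nat \<Rightarrow> nat" where
  "leaf_depth T r = card (path_edges [] (leaf T r))"

definition tree_depth :: "'l plane_tree \<Rightarrow> nat" where
  "tree_depth T = Max (leaf_depth T ` {1..num_leaves T})"


section \<open>The toric map and its kernel\<close>

text \<open>The variables of \<open>\<real>[\<Theta>, z]\<close>: \<open>Some \<theta>\<close> for a label \<open>\<theta>\<close>, and \<open>None\<close> for \<open>z\<close>.\<close>

abbreviation source_ring :: "'l plane_tree \<Rightarrow> nat mpoly ring" where
  "source_ring T \<equiv> poly_ring {1..num_leaves T}"

abbreviation target_ring :: "'l plane_tree \<Rightarrow> 'l option mpoly ring" where
  "target_ring T \<equiv> poly_ring (insert None (Some ` labels T))"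

definition sum_to_z_ideal :: "'l plane_tree \<Rightarrow> 'l option mpoly set" where
  "sum_to_z_ideal T = Idl\<^bsub>target_ring T\<^esub>
    {(\<Sum>e\<in>out_edges T v. mvar (Some (label T e))) - mvar None |v. v \<in> inner T}"

definition path_monomial :: "'l plane_tree \<Rightarrow> nat \<Rightarrow> 'l option mpoly" where
  "path_monomial T r =
    mvar None ^ (tree_depth T - leaf_depth T r) *
    (\<Prod>e\<in>path_edges [] (leaf T r). mvar (Some (label T e)))"

definition phi :: "'l plane_tree \<Rightarrow> nat mpoly \<Rightarrow> 'l option mpoly set" where
  "phi T f = sum_to_z_ideal T +>\<^bsub>target_ring T\<^esub> poly_subst (path_monomial T) f"

definition ker_phi :: "'l plane_tree \<Rightarrow> nat mpoly set" where
  "ker_phi T = a_kernel (source_ring T) (target_ring T Quot sum_to_z_ideal T) (phi T)"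


section \<open>The binomials\<close>

definition linear_binomials :: "'l plane_tree \<Rightarrow> nat mpoly set" where
  "linear_binomials T =
    {f. \<exists>r\<in>{1..num_leaves T}. \<exists>s\<in>{1..num_leaves T}.
      f = mvar r - mvar s \<and> f \<noteq> 0 \<and> f \<in> ker_phi T}"

definition quadratic_binomials :: "'l plane_tree \<Rightarrow> nat mpoly set" where
  "quadratic_binomials T =
    {f. \<exists>r\<^sub>1\<in>{1..num_leaves T}. \<exists>r\<^sub>2\<in>{1..num_leaves T}.
        \<exists>s\<^sub>1\<in>{1..num_leaves T}. \<exists>s\<^sub>2\<in>{1..num_leaves T}.
      f = mvar r\<^sub>1 * mvar r\<^sub>2 - mvar s\<^sub>1 * mvar s\<^sub>2 \<and> f \<noteq> 0 \<and> f \<in> ker_phi T \<and>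
      (\<exists>u v i j. (u, v) \<in> stage T \<and>
         prefix (u @ [i]) (leaf T r\<^sub>1) \<and> prefix (v @ [j]) (leaf T r\<^sub>2) \<and>
         prefix (u @ [j]) (leaf T s\<^sub>1) \<and> prefix (v @ [i]) (leaf T s\<^sub>2))}"

end

theory Submission
  imports Defs
begin

text \<open>
  The first step is that \<open>ker \<phi>\<close> lies in, and hence equals, the kernel of the monomial map
  (\<open>ker_phi_imp_subst_eq_zero\<close>). Weighting each label by the subtree polynomials at its end points
  turns arbitrary positive labels into labels that sum to \<open>z\<close> at every inner vertex; in a balanced
  tree this is consistent on stages, and, after a common rescaling of the labels and \<open>z\<close>, it does not
  change the values of the leaf monomials. So a
  polynomial in \<open>ker \<phi>\<close> is mapped to a polynomial that vanishes at all positive points, which is zero.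

  Hence the leading monomial of an element of \<open>ker \<phi>\<close> has the same image as some smaller monomial of
  that element, and it remains to show: if \<open>p^a \<succ> p^b\<close> have the same image, then \<open>p^a\<close> is divisible
  by the leading monomial of one of the given binomials (\<open>bottom_leaf_reduction\<close>). Without common
  factors, the bottommost leaf \<open>l\<close> occurs in \<open>p^b\<close> only. Follow the path to \<open>l\<close> as far as some path
  of \<open>p^a\<close> does, up to a vertex \<open>u\<close>, where \<open>l\<close> turns to \<open>u\<^sub>j\<close> and the path of \<open>p^a\<close> to some
  \<open>u\<^sub>i\<close> above it. Since the images agree, the label \<open>\<theta>\<^sub>j\<close> occurs on some path of \<open>p^a\<close>. If
  this is another factor of \<open>p^a\<close>, balancedness allows the two paths to be swapped
  (\<open>swap_paths\<close>), which yields a quadratic binomial whose other term has a lower leaf. Otherwise it occurs on the same path further down, and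
  then the labels \<open>\<theta>\<^sub>i\<close> and \<open>\<theta>\<^sub>j\<close> on that path can be exchanged (\<open>exchange_label_on_path\<close>), which
  yields a linear binomial.

  The exchange of labels rests on an identity for the subtree polynomials of a balanced tree,
  \<open>\<partial>t(u\<^sub>i) / \<partial>\<theta>\<^sub>j = \<partial>t(u\<^sub>j) / \<partial>\<theta>\<^sub>i\<close> (\<open>partial_subtree_poly_symmetric\<close>). It holds because,
  up to factors constant in the labels of a stage, a subtree polynomial depends on these labels only
  through a single linear form in them.
\<close>

abbreviation "lookup \<equiv> Poly_Mapping.lookup"
abbreviation "keys \<equiv> Poly_Mapping.keys"
abbreviation "single \<equiv> Poly_Mapping.single"

section \<open>Sums of monomials and evaluation at real points\<close>

lemma poly_mapping_eq_sum_single: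
  "f = (\<Sum>m\<in>keys f. single m (lookup f m))"
proof (rule poly_mapping_eqI)
  fix k
  have "lookup (\<Sum>m\<in>keys f. single m (lookup f m)) k = (\<Sum>m\<in>keys f. if m = k then lookup f m else 0)"
    by (simp add: lookup_sum lookup_single when_def)
  also have "\<dots> = lookup f k"
    by (simp add: in_keys_iff)
  finally show "lookup f k = lookup (\<Sum>m\<in>keys f. single m (lookup f m)) k" by simp
qed

lemma poly_mapping_single_add_induct [case_names single add]:
  fixes f :: "'a \<Rightarrow>\<^sub>0 'b::comm_monoid_add"
  assumes single: "\<And>m c. P (single m c)" and add: "\<And>f g. P f \<Longrightarrow> P g \<Longrightarrow> P (f + g)"
  shows "P f"
proof -
  have "P (\<Sum>m\<in>A. single m (lookup f m))" if "finite A" for A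
    using that
  proof induction
    case empty
    show ?case using single[of undefined 0] by simp
  qed (simp add: assms)
  from this[of "keys f"] show ?thesis
    by (simp flip: poly_mapping_eq_sum_single)
qed

lemma sum_keys_superset:
  assumes "finite A" "keys f \<subseteq> A" "\<And>m. h m 0 = 0"
  shows "(\<Sum>m\<in>keys f. h m (lookup f m)) = (\<Sum>m\<in>A. h m (lookup f m))"
  by (rule sum.mono_neutral_left) (use assms in \<open>auto simp: in_keys_iff\<close>)

definition mon_eval :: "('x \<Rightarrow> real) \<Rightarrow> ('x \<Rightarrow>\<^sub>0 nat) \<Rightarrow> real" where
  "mon_eval P m = (\<Prod>x\<in>keys m. P x ^ lookup m x)"

definition eval_poly :: "('x \<Rightarrow> real) \<Rightarrow> 'x mpoly \<Rightarrow> real" where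
  "eval_poly P f = (\<Sum>m\<in>keys f. lookup f m * mon_eval P m)"

lemma mon_eval_superset:
  assumes "finite A" "keys m \<subseteq> A"
  shows "mon_eval P m = (\<Prod>x\<in>A. P x ^ lookup m x)"
  unfolding mon_eval_def
  by (rule prod.mono_neutral_left) (use assms in \<open>auto simp: in_keys_iff\<close>)

lemma mon_eval_zero [simp]: "mon_eval P 0 = 1"
  by (simp add: mon_eval_def)

lemma mon_eval_add: "mon_eval P (m + m') = mon_eval P m * mon_eval P m'"
proof -
  let ?A = "keys m \<union> keys m'"
  have "mon_eval P (m + m') = (\<Prod>x\<in>?A. P x ^ lookup (m + m') x)"
    by (rule mon_eval_superset) (use Poly_Mapping.keys_add[of m m'] in auto)
  then show ?thesis
    by (simp add: mon_eval_superset[of ?A] lookup_add power_add prod.distrib)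
qed

lemma mon_eval_single: "mon_eval P (single x n) = P x ^ n"
  by (simp add: mon_eval_def)

lemma eval_poly_zero [simp]: "eval_poly P 0 = 0"
  by (simp add: eval_poly_def)

lemma eval_poly_single [simp]: "eval_poly P (single m c) = c * mon_eval P m"
  by (simp add: eval_poly_def)

lemma eval_poly_add [simp]: "eval_poly P (f + g) = eval_poly P f + eval_poly P g"
proof -
  let ?A = "keys f \<union> keys g"
  have *: "eval_poly P h = (\<Sum>m\<in>?A. lookup h m * mon_eval P m)" if "keys h \<subseteq> ?A" for h
    unfolding eval_poly_def by (rule sum_keys_superset) (use that in auto)
  show ?thesis
    using Poly_Mapping.keys_add[of f g]
    by (simp add: * lookup_add sum.distrib distrib_right)
qed

lemma eval_poly_mult [simp]: "eval_poly P (f * g) = eval_poly P f * eval_poly P g"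
proof (induction f rule: poly_mapping_single_add_induct)
  case (single m c)
  show ?case
    by (induction g rule: poly_mapping_single_add_induct)
      (simp_all add: mult_single mon_eval_add distrib_left)
qed (simp add: distrib_right)

lemma eval_poly_minus [simp]: "eval_poly P (f - g) = eval_poly P f - eval_poly P g"
  using eval_poly_add[of P "f - g" g] by simp

lemma eval_poly_one [simp]: "eval_poly P 1 = 1"
  by (simp flip: single_one)

lemma eval_poly_sum [simp]: "eval_poly P (\<Sum>i\<in>I. f i) = (\<Sum>i\<in>I. eval_poly P (f i))"
  by (induction I rule: infinite_finite_induct) auto

lemma eval_poly_prod [simp]: "eval_poly P (\<Prod>i\<in>I. f i) = (\<Prod>i\<in>I. eval_poly P (f i))"
  by (induction I rule: infinite_finite_induct) auto

lemma eval_poly_power [simp]: "eval_poly P (f ^ n) = eval_poly P f ^ n"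
  by (induction n) auto

lemma eval_poly_mvar [simp]: "eval_poly P (mvar x) = P x"
  by (simp add: mvar_def mon_eval_single)

text \<open>Dedekind's independence of characters: distinct monomials are distinct characters of the
  multiplicative group of positive points. If a combination vanishes everywhere, then so do its
  translate by \<open>Q\<close> and its multiple by the value of one character at \<open>Q\<close>; in their difference that
  character is gone, and induction on the number of characters applies.\<close>

lemma mon_eval_independent:
  fixes c :: "('x \<Rightarrow>\<^sub>0 nat) \<Rightarrow> real"
  assumes "finite A" "\<And>P. (\<And>x. P x > 0) \<Longrightarrow> (\<Sum>m\<in>A. c m * mon_eval P m) = 0" "m \<in> A"
  shows "c m = 0"
  using assms
proof (induction A arbitrary: c m rule: finite_induct)
  case (insert m0 A)
  have van: "c k = 0" if k: "k \<in> A" for k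
  proof -
    from k insert.hyps have "k \<noteq> m0" by auto
    then obtain y where y: "lookup k y \<noteq> lookup m0 y"
      by (meson poly_mapping_eqI)
    \<comment> \<open>The point \<open>Q\<close> separates the characters of \<open>k\<close> and \<open>m0\<close>, which differ in the exponent of \<open>y\<close>.\<close>
    define Q :: "'x \<Rightarrow> real" where "Q = (\<lambda>x. if x = y then 2 else 1)"
    have Q: "Q x > 0" for x by (simp add: Q_def)
    have Qm: "mon_eval Q m = 2 ^ lookup m y" for m
    proof -
      have "mon_eval Q m = (\<Prod>x\<in>insert y (keys m). Q x ^ lookup m x)"
        by (rule mon_eval_superset) auto
      also have "\<dots> = (\<Prod>x\<in>insert y (keys m). if x = y then 2 ^ lookup m y else 1)"
        by (rule prod.cong) (auto simp: Q_def)
      finally show ?thesis by simp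
    qed
    have "c k * (mon_eval Q k - mon_eval Q m0) = 0"
    proof (rule insert.IH[where c = "\<lambda>k. c k * (mon_eval Q k - mon_eval Q m0)", OF _ k])
      fix P :: "'x \<Rightarrow> real" assume P: "\<And>x. P x > 0"
      have PQ: "mon_eval (\<lambda>x. P x * Q x) m = mon_eval P m * mon_eval Q m" for m
        by (simp add: mon_eval_def power_mult_distrib prod.distrib)
      have "0 = (\<Sum>m\<in>insert m0 A. c m * mon_eval (\<lambda>x. P x * Q x) m)
              - mon_eval Q m0 * (\<Sum>m\<in>insert m0 A. c m * mon_eval P m)"
        using insert.prems(1)[of P] insert.prems(1)[of "\<lambda>x. P x * Q x"] P Q by simp
      also have "\<dots> = (\<Sum>m\<in>A. c m * (mon_eval Q m - mon_eval Q m0) * mon_eval P m)"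
        using insert.hyps
        by (simp add: PQ sum_distrib_left algebra_simps flip: sum_subtractf)
      finally show "(\<Sum>m\<in>A. c m * (mon_eval Q m - mon_eval Q m0) * mon_eval P m) = 0" by simp
    qed
    then show ?thesis using y by (simp add: Qm)
  qed
  have "(\<Sum>m\<in>insert m0 A. c m * mon_eval (\<lambda>_. 1) m) = 0"
    by (rule insert.prems) simp
  then have "c m0 = 0"
    using insert.hyps van by (simp add: mon_eval_def)
  with van insert.prems show ?case by auto
qed simp

lemma eval_poly_eq_zero_imp_eq_zero:
  assumes "\<And>P. (\<And>x. P x > 0) \<Longrightarrow> eval_poly P f = 0"
  shows "f = 0"
proof -
  have "lookup f m = 0" if "m \<in> keys f" for m
    by (rule mon_eval_independent[OF _ _ that]) (use assms in \<open>auto simp: eval_poly_def\<close>)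
  then show ?thesis
    by (intro poly_mapping_eqI) (auto simp: in_keys_iff)
qed

text \<open>Subtree polynomials are sums of monomials, hence positive at positive points. This allows them
  to be cancelled without any order on the variables, from which the absence of zero divisors would
  usually be derived.\<close>

lemma mult_left_cancel_of_eval_pos:
  assumes "\<And>P. (\<And>x. P x > 0) \<Longrightarrow> eval_poly P b > 0" "b * f = b * g"
  shows "f = g"
proof -
  have "f - g = 0"
  proof (rule eval_poly_eq_zero_imp_eq_zero)
    fix P :: "'a \<Rightarrow> real" assume "\<And>x. P x > 0"
    moreover have "eval_poly P b * eval_poly P f = eval_poly P b * eval_poly P g"
      using assms(2) by (metis eval_poly_mult)
    ultimately show "eval_poly P (f - g) = 0"
      using assms(1)[of P] by simp
  qed
  then show ?thesis by simp
qed

section \<open>Partial derivatives\<close>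

text \<open>The truncated difference \<open>m - single x 1\<close> is wrong as a quotient exactly when \<open>x\<close> does not divide
  the monomial \<open>m\<close>, and then its coefficient is \<open>0\<close>.\<close>

definition partial :: "'x \<Rightarrow> 'x mpoly \<Rightarrow> 'x mpoly" where
  "partial x f = (\<Sum>m\<in>keys f. single (m - single x 1) (lookup f m * lookup m x))"

lemma partial_add: "partial x (f + g) = partial x f + partial x g"
proof -
  let ?A = "keys f \<union> keys g"
  have *: "partial x h = (\<Sum>m\<in>?A. single (m - single x 1) (lookup h m * lookup m x))"
    if "keys h \<subseteq> ?A" for h
    unfolding partial_def by (rule sum_keys_superset) (use that in auto)
  show ?thesis
    using Poly_Mapping.keys_add[of f g]
    by (simp add: * lookup_add sum.distrib distrib_right single_add)
qed

lemma partial_single: "partial x (single m c) = single (m - single x 1) (c * lookup m x)"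
  by (simp add: partial_def)

lemma partial_sum: "partial x (\<Sum>i\<in>I. f i) = (\<Sum>i\<in>I. partial x (f i))"
  by (induction I rule: infinite_finite_induct) (auto simp: partial_add partial_def[of x 0])

lemma single_minus_add_comm:
  fixes m m' :: "'x \<Rightarrow>\<^sub>0 nat"
  assumes "lookup m x \<noteq> 0"
  shows "m - single x 1 + m' = m + m' - single x 1"
  by (rule poly_mapping_eqI) (use assms in \<open>auto simp: lookup_add lookup_minus lookup_single when_def\<close>)

lemma partial_mult: "partial x (f * g) = partial x f * g + f * partial x g"
proof (induction f rule: poly_mapping_single_add_induct)
  case (single m c)
  show ?case
  proof (induction g rule: poly_mapping_single_add_induct)
    case (single m' c')
    have 1: "single (m - single x 1 + m') (c * c' * lookup m x) = single (m + m' - single x 1) (c * c' * lookup m x)"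
      by (cases "lookup m x = 0") (simp_all add: single_minus_add_comm del: One_nat_def)
    have 2: "single (m + (m' - single x 1)) (c * c' * lookup m' x) = single (m + m' - single x 1) (c * c' * lookup m' x)"
      using single_minus_add_comm[of m' x m]
      by (cases "lookup m' x = 0") (auto simp: add.commute)
    show ?case
      using 1 2 by (simp add: partial_single mult_single lookup_add algebra_simps single_add)
  qed (simp_all add: partial_add algebra_simps)
qed (simp_all add: partial_add algebra_simps)

lemma lookup_partial: "lookup (partial x f) m = (lookup m x + 1) * lookup f (m + single x 1)"
proof (induction f rule: poly_mapping_single_add_induct)
  case (single m' c)
  have "m' - single x 1 = m \<longleftrightarrow> m' = m + single x 1" if "lookup m' x \<noteq> 0"
    using that single_minus_add_comm[of m' x "single x 1"] by auto
  then show ?case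
    by (cases "lookup m' x = 0")
      (auto simp: partial_single lookup_single when_def lookup_add)
qed (simp add: partial_add lookup_add algebra_simps)

lemma partial_mvar: "partial x (mvar y) = (if x = y then 1 else 0)"
  by (auto simp: mvar_def partial_single lookup_single when_def)

lemma partial_one [simp]: "partial x 1 = 0"
  by (simp flip: single_one add: partial_single)

lemma partial_eq_zero:
  assumes "\<And>m. m \<in> keys f \<Longrightarrow> lookup m x = 0"
  shows "partial x f = 0"
  using assms by (simp add: partial_def)

section \<open>Paths and subtree polynomials\<close>

context staged_tree
begin

abbreviation "lab v i \<equiv> label T (v, v @ [i])"

definition children :: "vertex \<Rightarrow> nat set" where
  "children v = {i. v @ [i] \<in> verts T}"

definition leaves_below :: "vertex \<Rightarrow> vertex set" where
  "leaves_below v = {w \<in> leaves T. prefix v w}"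

text \<open>The edge at depth \<open>k\<close> on the way to \<open>w\<close> leaves the vertex \<open>take k w\<close> towards its child number
  \<open>w ! k\<close>. Indexing by depth, instead of by edges, makes paths split into intervals.\<close>

definition path_exp :: "vertex \<Rightarrow> vertex \<Rightarrow> ('l \<Rightarrow>\<^sub>0 nat)" where
  "path_exp v w = (\<Sum>k\<in>{length v..<length w}. single (lab (take k w) (w ! k)) 1)"

lemma out_edges_eq: "out_edges T v = (\<lambda>i. (v, v @ [i])) ` children v"
  by (auto simp: out_edges_def children_def)

lemma inner_iff: "v \<in> inner T \<longleftrightarrow> children v \<noteq> {}"
  using parent by (auto simp: inner_def out_edges_eq) (auto simp: children_def)

lemma inner_iff': "v \<in> inner T \<longleftrightarrow> (\<exists>i. v @ [i] \<in> verts T)"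
  by (auto simp: inner_iff children_def)

lemma finite_children: "finite (children v)"
proof -
  have "inj_on (\<lambda>i. v @ [i]) (children v)" by (auto simp: inj_on_def)
  moreover have "(\<lambda>i. v @ [i]) ` children v \<subseteq> verts T" by (auto simp: children_def)
  ultimately show ?thesis
    using finite_verts finite_subset finite_imageD by metis
qed

lemma prefix_in_verts:
  assumes "w \<in> verts T" "prefix v w"
  shows "v \<in> verts T"
proof -
  have "v @ x \<in> verts T \<Longrightarrow> v \<in> verts T" for x
    by (induction x rule: rev_induct) (auto simp flip: append_assoc dest: parent)
  with assms show ?thesis by (auto simp: prefix_def)
qed

lemma verts_induct [consumes 1, case_names vertex]:
  assumes "v \<in> verts T"
    and "\<And>v. v \<in> verts T \<Longrightarrow> (\<And>i. i \<in> children v \<Longrightarrow> P (v @ [i])) \<Longrightarrow> P v"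
  shows "P v"
  using assms(1)
proof (induction "Max (length ` verts T) - length v" arbitrary: v rule: less_induct)
  case less
  show ?case
  proof (rule assms(2)[OF less.prems])
    fix i assume "i \<in> children v"
    then have i: "v @ [i] \<in> verts T" by (simp add: children_def)
    then have "length (v @ [i]) \<le> Max (length ` verts T)"
      using finite_verts by (intro Max_ge) blast+
    then show "P (v @ [i])" by (intro less.hyps i) simp
  qed
qed

lemma verts_eq_leaf_or_inner: "v \<in> verts T \<longleftrightarrow> v \<in> leaves T \<or> v \<in> inner T"
  by (auto simp: leaves_def inner_def)

lemma finite_leaves: "finite (leaves T)"
  using finite_verts by (simp add: leaves_def)

lemma leaf_in_verts: "w \<in> leaves T \<Longrightarrow> w \<in> verts T"
  by (simp add: leaves_def)

lemma leaf_prefix_imp_eq: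
  assumes "v \<in> leaves T" "w \<in> verts T" "prefix v w"
  shows "w = v"
proof -
  obtain x where x: "w = v @ x" using assms(3) by (auto simp: prefix_def)
  show ?thesis
  proof (cases x)
    case (Cons i y)
    have "v @ [i] \<in> verts T"
      by (rule prefix_in_verts[OF assms(2)]) (simp add: x Cons)
    then have "v \<in> inner T" by (auto simp: inner_iff')
    with assms(1) show ?thesis by (simp add: leaves_def)
  qed (use x in simp)
qed

lemma finite_leaves_below: "finite (leaves_below v)"
  using finite_leaves by (simp add: leaves_below_def)

lemma leaves_below_leaf: "v \<in> leaves T \<Longrightarrow> leaves_below v = {v}"
  using leaf_prefix_imp_eq leaf_in_verts by (auto simp: leaves_below_def)

lemma leaves_below_inner:
  assumes "v \<in> inner T"
  shows "leaves_below v = (\<Union>i\<in>children v. leaves_below (v @ [i]))"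
proof (intro equalityI subsetI)
  fix w assume w: "w \<in> leaves_below v"
  then obtain x where x: "w = v @ x" "w \<in> leaves T" by (auto simp: leaves_below_def prefix_def)
  with assms obtain i y where y: "x = i # y" by (cases x) (auto simp: leaves_def)
  then have "prefix (v @ [i]) w" using x by simp
  moreover from this have "v @ [i] \<in> verts T"
    using prefix_in_verts leaf_in_verts x by blast
  ultimately show "w \<in> (\<Union>i\<in>children v. leaves_below (v @ [i]))"
    using x by (auto simp: leaves_below_def children_def)
qed (auto simp: leaves_below_def dest: append_prefixD)

text \<open>The edges of a path start at vertices of different depths, so indexing them by depth is
  injective.\<close>

lemma path_edges_prod:
  "(\<Prod>e\<in>path_edges v w. F e) = (\<Prod>k\<in>{length v..<length w}. F (take k w, take k w @ [w ! k]))"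
proof -
  let ?f = "\<lambda>k. (take k w, take (Suc k) w)"
  have "path_edges v w = ?f ` {length v..<length w}"
    by (auto simp: path_edges_def)
  moreover have "inj_on ?f {length v..<length w}"
  proof (rule inj_onI)
    fix k l assume "k \<in> {length v..<length w}" "l \<in> {length v..<length w}" "?f k = ?f l"
    then have "length (take k w) = length (take l w)" "k < length w" "l < length w" by auto
    then show "k = l" by simp
  qed
  ultimately have "(\<Prod>e\<in>path_edges v w. F e) = (\<Prod>k\<in>{length v..<length w}. F (?f k))"
    by (simp add: prod.reindex o_def)
  also have "\<dots> = (\<Prod>k\<in>{length v..<length w}. F (take k w, take k w @ [w ! k]))"
    by (rule prod.cong) (auto simp: take_Suc_conv_app_nth)
  finally show ?thesis .
qed

lemma card_path_edges: "card (path_edges v w) = length w - length v"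
proof -
  \<comment> \<open>The product of the constant \<open>2\<close> over a finite set determines its size.\<close>
  have "(2::nat) ^ card (path_edges v w) = 2 ^ (length w - length v)"
    using path_edges_prod[of "\<lambda>_. 2::nat" v w] by simp
  then show ?thesis by simp
qed

lemma path_monomial_single: "(\<Prod>e\<in>path_edges v w. mvar (label T e)) = single (path_exp v w) 1"
proof -
  have "(\<Prod>k\<in>A. mvar (f k)) = single (\<Sum>k\<in>A. single (f k) 1) 1" for A :: "nat set" and f :: "nat \<Rightarrow> 'l"
    by (induction A rule: infinite_finite_induct) (auto simp: mvar_def mult_single)
  then show ?thesis by (simp add: path_edges_prod path_exp_def)
qed

lemma path_exp_refl [simp]: "path_exp v v = 0"
  by (simp add: path_exp_def)

lemma path_exp_split:
  assumes "prefix u v" "prefix v w"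
  shows "path_exp u w = path_exp u v + path_exp v w"
proof -
  from assms obtain y where w: "w = v @ y" by (auto simp: prefix_def)
  have len: "length u \<le> length v" "length v \<le> length w"
    using assms prefix_length_le by auto
  have "path_exp u w = (\<Sum>k\<in>{length u..<length v}. single (lab (take k w) (w ! k)) 1) + path_exp v w"
    unfolding path_exp_def by (rule sum.atLeastLessThan_concat[symmetric]) (use len in auto)
  also have "(\<Sum>k\<in>{length u..<length v}. single (lab (take k w) (w ! k)) 1) = path_exp u v"
    unfolding path_exp_def by (rule sum.cong) (auto simp: w nth_append)
  finally show ?thesis .
qed

lemma path_exp_edge: "path_exp v (v @ [i]) = single (lab v i) 1"
  by (simp add: path_exp_def nth_append)

lemma path_exp_child:
  assumes "prefix (v @ [i]) w"
  shows "path_exp v w = single (lab v i) 1 + path_exp (v @ [i]) w"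
  using path_exp_split[of v "v @ [i]" w] assms by (simp add: path_exp_edge)

lemma subtree_poly_eq: "subtree_poly T v = (\<Sum>w\<in>leaves_below v. single (path_exp v w) 1)"
  by (simp add: subtree_poly_def leaves_below_def path_monomial_single)

lemma subtree_poly_leaf: "v \<in> leaves T \<Longrightarrow> subtree_poly T v = 1"
  by (simp add: subtree_poly_eq leaves_below_leaf)

lemma subtree_poly_inner:
  assumes "v \<in> inner T"
  shows "subtree_poly T v = (\<Sum>i\<in>children v. mvar (lab v i) * subtree_poly T (v @ [i]))"
proof -
  have "leaves_below (v @ [i]) \<inter> leaves_below (v @ [j]) = {}" if "i \<noteq> j" for i j
    using that by (auto simp: leaves_below_def prefix_def)
  then have "subtree_poly T v = (\<Sum>i\<in>children v. \<Sum>w\<in>leaves_below (v @ [i]). single (path_exp v w) 1)"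
    unfolding subtree_poly_eq leaves_below_inner[OF assms]
    by (intro sum.UNION_disjoint) (auto simp: finite_children finite_leaves_below)
  also have "\<dots> = (\<Sum>i\<in>children v. mvar (lab v i) * subtree_poly T (v @ [i]))"
    unfolding subtree_poly_eq sum_distrib_left
  proof (intro sum.cong refl)
    fix i w assume "w \<in> leaves_below (v @ [i])"
    then show "single (path_exp v w) 1 = mvar (lab v i) * single (path_exp (v @ [i]) w) 1"
      using path_exp_child[of v i w] by (simp add: mvar_def mult_single leaves_below_def)
  qed
  finally show ?thesis .
qed

lemma eval_subtree_poly_pos:
  assumes "v \<in> verts T" "\<And>x. P x > 0"
  shows "eval_poly P (subtree_poly T v) > 0"
  using assms(1)
proof (induction rule: verts_induct)
  case (vertex v)
  show ?case
  proof (cases "v \<in> leaves T")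
    case False
    with vertex have inner: "v \<in> inner T" by (simp add: verts_eq_leaf_or_inner)
    have "(\<Sum>i\<in>children v. P (lab v i) * eval_poly P (subtree_poly T (v @ [i]))) > 0"
      using inner vertex assms(2) finite_children by (intro sum_pos) (auto simp: inner_iff)
    then show ?thesis using inner by (simp add: subtree_poly_inner)
  qed (simp add: subtree_poly_leaf)
qed

lemma lookup_subtree_poly:
  "lookup (subtree_poly T v) m = card {w \<in> leaves_below v. path_exp v w = m}"
  by (simp add: subtree_poly_eq lookup_sum lookup_single when_def finite_leaves_below
      flip: sum.inter_filter)

lemma keys_subtree_poly: "keys (subtree_poly T v) = path_exp v ` leaves_below v"
proof -
  have "m \<in> keys (subtree_poly T v) \<longleftrightarrow> m \<in> path_exp v ` leaves_below v" for m
    using finite_leaves_below[of v] by (auto simp: in_keys_iff lookup_subtree_poly card_eq_0_iff)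
  then show ?thesis by blast
qed

text \<open>The coefficients of the product count pairs of paths, so nothing cancels.\<close>

lemma keys_mult_subtree_poly:
  "keys (subtree_poly T v * subtree_poly T v') =
    {path_exp v w + path_exp v' w' |w w'. w \<in> leaves_below v \<and> w' \<in> leaves_below v'}"
proof -
  let ?D = "leaves_below v \<times> leaves_below v'"
  have eq: "subtree_poly T v * subtree_poly T v' = (\<Sum>(w, w')\<in>?D. single (path_exp v w + path_exp v' w') 1)"
    by (simp add: subtree_poly_eq sum_product mult_single sum.cartesian_product)
  have "lookup (subtree_poly T v * subtree_poly T v') m
      = card {p \<in> ?D. path_exp v (fst p) + path_exp v' (snd p) = m}" for m
    unfolding eq
    by (simp add: lookup_sum lookup_single when_def finite_leaves_below case_prod_unfold
      flip: sum.inter_filter)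
  moreover have "finite {p \<in> ?D. path_exp v (fst p) + path_exp v' (snd p) = m}" for m
    by (simp add: finite_leaves_below)
  ultimately have "m \<in> keys (subtree_poly T v * subtree_poly T v') \<longleftrightarrow>
      (\<exists>p\<in>?D. path_exp v (fst p) + path_exp v' (snd p) = m)" for m
    by (auto simp: in_keys_iff card_eq_0_iff)
  then show ?thesis by fastforce
qed

text \<open>Different stages have disjoint label sets, and within a stage the order of the children matches
  the labels: a label determines the stage and the position of the child.\<close>

lemma label_eq_imp_same_stage:
  assumes "u @ [i] \<in> verts T" "v @ [j] \<in> verts T" "lab u i = lab v j"
  shows "(u, v) \<in> stage T" "i = j"
proof -
  have inner: "u \<in> inner T" "v \<in> inner T" using assms by (auto simp: inner_iff')
  have "lab u i \<in> label T ` out_edges T u" "lab v j \<in> label T ` out_edges T v"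
    using assms(1,2) by (auto simp: out_edges_def)
  then show st: "(u, v) \<in> stage T"
    using stage_disjoint[OF inner] assms(3) by auto
  have i: "v @ [i] \<in> verts T" "lab u i = lab v i"
    using stage_order[OF st assms(1)] by auto
  have "(v, v @ [i]) = (v, v @ [j])"
    by (rule inj_onD[OF labels_distinct[OF inner(2)]]) (use assms i in \<open>auto simp: out_edges_def\<close>)
  then show "i = j" by simp
qed

lemma stage_children:
  assumes "(u, v) \<in> stage T"
  shows "children u = children v" "i \<in> children u \<Longrightarrow> lab u i = lab v i"
proof -
  have "(v, u) \<in> stage T" using stage_equiv assms by (auto simp: equiv_def sym_def)
  then show "children u = children v"
    using stage_order[of u v] stage_order[of v u] assms unfolding children_def by blast
  show "i \<in> children u \<Longrightarrow> lab u i = lab v i"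
    using stage_order[OF assms] unfolding children_def by blast
qed

lemma lookup_path_exp_pos_imp_edge:
  assumes "lookup (path_exp v w) x \<noteq> 0" "w \<in> verts T"
  obtains k where "length v \<le> k" "k < length w" "take k w @ [w ! k] \<in> verts T"
    "prefix (take k w @ [w ! k]) w" "lab (take k w) (w ! k) = x"
proof -
  have "(\<Sum>k\<in>{length v..<length w}. lookup (single (lab (take k w) (w ! k)) (1::nat)) x) \<noteq> 0"
    using assms(1) by (simp add: path_exp_def lookup_sum)
  then obtain k where k: "k \<in> {length v..<length w}" "lookup (single (lab (take k w) (w ! k)) (1::nat)) x \<noteq> 0"
    by (meson sum.neutral)
  have pre: "prefix (take k w @ [w ! k]) w"
    using k by (metis atLeastLessThan_iff take_Suc_conv_app_nth take_is_prefix)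
  show ?thesis
    by (rule that[of k]) (use k pre prefix_in_verts[OF assms(2) pre] in \<open>auto simp: lookup_single when_def split: if_splits\<close>)
qed

end

section \<open>Swaps and exchanges of labels in balanced trees\<close>

locale balanced_staged_tree = staged_tree T for T :: "'l plane_tree" +
  assumes balanced: "balanced T"
begin

lemma balanced_eq:
  assumes "(u, v) \<in> stage T" "i \<in> children u" "j \<in> children u"
  shows "subtree_poly T (u @ [i]) * subtree_poly T (v @ [j]) =
    subtree_poly T (u @ [j]) * subtree_poly T (v @ [i])"
  using assms balanced by (auto simp: balanced_def children_def)

text \<open>Where balancedness produces quadratic binomials: the monomial of a pair of paths occurs in
  \<open>t(u\<^sub>i) t(v\<^sub>j)\<close>, hence in \<open>t(u\<^sub>j) t(v\<^sub>i)\<close>, and so comes from a pair of paths through \<open>u\<^sub>j\<close>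
  and \<open>v\<^sub>i\<close>. The labels of the two exchanged edges are the same on both sides.\<close>

lemma swap_paths:
  assumes "(u, v) \<in> stage T" "i \<in> children u" "j \<in> children u"
    and "w1 \<in> leaves_below (u @ [i])" "w2 \<in> leaves_below (v @ [j])"
  obtains s1 s2 where "s1 \<in> leaves_below (u @ [j])" "s2 \<in> leaves_below (v @ [i])"
    "path_exp [] w1 + path_exp [] w2 = path_exp [] s1 + path_exp [] s2"
proof -
  have "path_exp (u @ [i]) w1 + path_exp (v @ [j]) w2 \<in> keys (subtree_poly T (u @ [i]) * subtree_poly T (v @ [j]))"
    using assms by (auto simp: keys_mult_subtree_poly)
  also have "\<dots> = keys (subtree_poly T (u @ [j]) * subtree_poly T (v @ [i]))"
    using assms by (simp add: balanced_eq)
  finally obtain s1 s2 where s: "s1 \<in> leaves_below (u @ [j])" "s2 \<in> leaves_below (v @ [i])"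
    "path_exp (u @ [i]) w1 + path_exp (v @ [j]) w2 = path_exp (u @ [j]) s1 + path_exp (v @ [i]) s2"
    by (auto simp: keys_mult_subtree_poly)
  have split: "path_exp [] w = path_exp [] x + (single (lab x k) 1 + path_exp (x @ [k]) w)"
    if "w \<in> leaves_below (x @ [k])" for w x k
    using that path_exp_split[of "[]" x w] path_exp_child[of x k w]
    by (auto simp: leaves_below_def dest: append_prefixD)
  have "path_exp [] w1 + path_exp [] w2 = path_exp [] u + path_exp [] v + (single (lab u i) 1 + single (lab v j) 1)
    + (path_exp (u @ [i]) w1 + path_exp (v @ [j]) w2)"
    using assms split by (simp add: algebra_simps)
  also have "\<dots> = path_exp [] s1 + path_exp [] s2"
    using assms s split stage_children[OF assms(1)] by (simp add: algebra_simps)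
  finally show ?thesis using that s by blast
qed

text \<open>Below a vertex of maximal depth in its stage, no further vertex of that stage occurs. So the
  polynomials of its children are constant in the labels of the stage.\<close>

lemma deepest_stage_vertex:
  assumes "u \<in> inner T"
  obtains v0 where "(u, v0) \<in> stage T"
    "\<And>i j. i \<in> children u \<Longrightarrow> j \<in> children u \<Longrightarrow> partial (lab u j) (subtree_poly T (v0 @ [i])) = 0"
proof -
  let ?S = "{v. (u, v) \<in> stage T}"
  have u: "(u, u) \<in> stage T"
    using assms stage_equiv by (simp add: equiv_def refl_on_def inner_def)
  have sub: "?S \<subseteq> verts T"
    using stage_equiv by (auto dest: equiv_type)
  then have fin: "finite (length ` ?S)" using finite_verts finite_subset by blast
  have "Max (length ` ?S) \<in> length ` ?S" by (rule Max_in) (use fin u in auto)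
  then obtain v0 where v0: "(u, v0) \<in> stage T" "length v0 = Max (length ` ?S)" by auto
  have max: "length v \<le> length v0" if "(u, v) \<in> stage T" for v
    using fin that v0(2) by (simp add: Max_ge)
  show ?thesis
  proof (rule that[OF v0(1)])
    fix i j assume ij: "i \<in> children u" "j \<in> children u"
    show "partial (lab u j) (subtree_poly T (v0 @ [i])) = 0"
    proof (rule partial_eq_zero)
      fix m assume "m \<in> keys (subtree_poly T (v0 @ [i]))"
      then obtain w where w: "w \<in> leaves T" "m = path_exp (v0 @ [i]) w"
        by (auto simp: keys_subtree_poly leaves_below_def)
      show "lookup m (lab u j) = 0"
      proof (rule ccontr)
        assume "lookup m (lab u j) \<noteq> 0"
        then obtain k where k: "length (v0 @ [i]) \<le> k" "k < length w" "take k w @ [w ! k] \<in> verts T"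
          "lab (take k w) (w ! k) = lab u j"
          using lookup_path_exp_pos_imp_edge[of "v0 @ [i]" w "lab u j"] leaf_in_verts[OF w(1)] w(2) by blast
        have "(u, take k w) \<in> stage T"
          by (rule label_eq_imp_same_stage[of u j _ "w ! k"]) (use k ij in \<open>auto simp: children_def\<close>)
        from max[OF this] k show False by simp
      qed
    qed
  qed
qed

text \<open>Let \<open>v\<^sub>0\<close> be a deepest vertex in the stage of \<open>u\<close>, let \<open>B\<^sub>i\<close> be the polynomials of its
  children, which are constant in the labels \<open>\<theta>\<^sub>i\<close> of the stage, and let \<open>L = t(v\<^sub>0) = \<Sum>\<^sub>i \<theta>\<^sub>i B\<^sub>i\<close>. For
  every \<open>v\<close> in the stage, balancedness gives \<open>B\<^sub>l t(v) = L t(v\<^sub>l)\<close>. So the \<open>\<theta>\<^sub>i\<close> enter subtree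
  polynomials only through \<open>L\<close>, up to factors constant in them; this is expressed by
  \<open>B\<^sub>j \<partial>\<^sub>i t(v) = B\<^sub>i \<partial>\<^sub>j t(v)\<close>, which holds for all vertices \<open>v\<close> by induction along the tree. The
  claim then follows by differentiating \<open>B\<^sub>i t(u\<^sub>j) = B\<^sub>j t(u\<^sub>i)\<close>.\<close>

lemma partial_subtree_poly_symmetric:
  assumes u: "u \<in> inner T" and ij: "i \<in> children u" "j \<in> children u"
  shows "partial (lab u i) (subtree_poly T (u @ [j])) = partial (lab u j) (subtree_poly T (u @ [i]))"
proof -
  obtain v0 where v0: "(u, v0) \<in> stage T"
    and free: "\<And>i j. i \<in> children u \<Longrightarrow> j \<in> children u \<Longrightarrow> partial (lab u j) (subtree_poly T (v0 @ [i])) = 0"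
    using deepest_stage_vertex[OF u] by blast
  define B where "B i = subtree_poly T (v0 @ [i])" for i
  define L where "L = subtree_poly T v0"
  have ch0: "children v0 = children u" "\<And>i. i \<in> children u \<Longrightarrow> lab v0 i = lab u i"
    using stage_children[OF v0] by auto
  have v0_inner: "v0 \<in> inner T" using u ch0 by (simp add: inner_iff)
  have cancel: "f = g" if "B l * f = B l * g" "l \<in> children u" for f g l
    by (rule mult_left_cancel_of_eval_pos[OF _ that(1)])
      (use that(2) ch0 in \<open>auto simp: B_def children_def intro!: eval_subtree_poly_pos\<close>)
  have dB: "partial (lab u i) (B l) = 0" if "i \<in> children u" "l \<in> children u" for i l
    using free that by (simp add: B_def)
  have dlab: "lab u i = lab u l \<longleftrightarrow> i = l" if "i \<in> children u" "l \<in> children u" for i l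
    using that label_eq_imp_same_stage(2)[of u i u l] by (auto simp: children_def)
  have dL: "partial (lab u i) L = B i" if "i \<in> children u" for i
  proof -
    have "partial (lab u i) L = (\<Sum>l\<in>children u. if l = i then B l else 0)"
      unfolding L_def subtree_poly_inner[OF v0_inner] partial_sum ch0
      by (rule sum.cong) (use that dlab dB in \<open>auto simp: partial_mult partial_mvar ch0(2) B_def[symmetric]\<close>)
    also have "\<dots> = B i" using that finite_children by simp
    finally show ?thesis .
  qed
  have sym: "B j * partial (lab u i) (subtree_poly T v) = B i * partial (lab u j) (subtree_poly T v)"
    if "v \<in> verts T" "i \<in> children u" "j \<in> children u" for v i j
    using that(1)
  proof (induction rule: verts_induct)
    case (vertex v)
    consider "v \<in> leaves T" | "v \<in> inner T" "(u, v) \<notin> stage T" | "v \<in> inner T" "(u, v) \<in> stage T"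
      using vertex by (auto simp: verts_eq_leaf_or_inner)
    then show ?case
    proof cases
      case 1
      then show ?thesis by (simp add: subtree_poly_leaf)
    next
      case 2
      have ne: "lab u i \<noteq> lab v l" if "i \<in> children u" "l \<in> children v" for i l
        using 2 that label_eq_imp_same_stage(1)[of u i v l] by (auto simp: children_def)
      have d: "partial (lab u i) (subtree_poly T v) =
          (\<Sum>l\<in>children v. mvar (lab v l) * partial (lab u i) (subtree_poly T (v @ [l])))"
        if "i \<in> children u" for i
        unfolding subtree_poly_inner[OF 2(1)] partial_sum
        by (rule sum.cong) (use that ne in \<open>auto simp: partial_mult partial_mvar\<close>)
      show ?thesis
        unfolding d[OF that(2)] d[OF that(3)] sum_distrib_left
        by (rule sum.cong) (simp_all add: mult.left_commute[of "B _"] vertex.IH)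
    next
      case 3
      have chv: "children v = children u" "\<And>i. i \<in> children u \<Longrightarrow> lab v i = lab u i"
        using stage_children[OF 3(2)] by auto
      have vv0: "(v, v0) \<in> stage T"
        using 3(2) v0 stage_equiv by (meson equiv_def symD transD)
      \<comment> \<open>Exchange the factors of each summand of \<open>B\<^sub>i t(v)\<close> by balancedness of the pair \<open>v\<close>, \<open>v0\<close>.\<close>
      have BL: "B i * subtree_poly T v = L * subtree_poly T (v @ [i])"
      proof -
        have "B i * subtree_poly T v = (\<Sum>l\<in>children u. mvar (lab u l) * (subtree_poly T (v @ [l]) * B i))"
          unfolding subtree_poly_inner[OF 3(1)] chv sum_distrib_left
          by (rule sum.cong) (auto simp: chv algebra_simps)
        also have "\<dots> = (\<Sum>l\<in>children u. mvar (lab u l) * (subtree_poly T (v @ [i]) * B l))"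
        proof (rule sum.cong)
          fix l assume "l \<in> children u"
          then show "mvar (lab u l) * (subtree_poly T (v @ [l]) * B i) = mvar (lab u l) * (subtree_poly T (v @ [i]) * B l)"
            using balanced_eq[OF vv0, of l i] that(2) chv(1) by (simp add: B_def)
        qed simp
        also have "\<dots> = L * subtree_poly T (v @ [i])"
          unfolding L_def subtree_poly_inner[OF v0_inner] ch0 sum_distrib_right
          by (rule sum.cong) (auto simp: ch0 B_def algebra_simps)
        finally show ?thesis .
      qed
      have d: "B i * partial (lab u k) (subtree_poly T v) =
          B k * subtree_poly T (v @ [i]) + L * partial (lab u k) (subtree_poly T (v @ [i]))"
        if "k \<in> children u" for k
        using arg_cong[OF BL, of "partial (lab u k)"] that \<open>i \<in> children u\<close> dB dL
        by (simp add: partial_mult)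
      have "B i * (B j * partial (lab u i) (subtree_poly T v)) = B i * (B i * partial (lab u j) (subtree_poly T v))"
      proof -
        have "B i * (B j * partial (lab u i) (subtree_poly T v)) = B j * (B i * partial (lab u i) (subtree_poly T v))"
          by (simp add: mult.left_commute)
        also have "\<dots> = B j * B i * subtree_poly T (v @ [i]) + L * (B j * partial (lab u i) (subtree_poly T (v @ [i])))"
          using that by (simp add: d algebra_simps)
        also have "B j * partial (lab u i) (subtree_poly T (v @ [i])) = B i * partial (lab u j) (subtree_poly T (v @ [i]))"
          using vertex.IH that chv by simp
        also have "B j * B i * subtree_poly T (v @ [i]) + L * \<dots> = B i * (B i * partial (lab u j) (subtree_poly T v))"
          using that by (simp add: d algebra_simps)
        finally show ?thesis .
      qed
      then show ?thesis using cancel that by blast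
    qed
  qed
  have bal: "B i * subtree_poly T (u @ [j]) = B j * subtree_poly T (u @ [i])"
    using balanced_eq[OF v0 ij] by (simp add: B_def mult.commute)
  have "B i * partial (lab u i) (subtree_poly T (u @ [j])) = B j * partial (lab u i) (subtree_poly T (u @ [i]))"
    using arg_cong[OF bal, of "partial (lab u i)"] dB ij by (simp add: partial_mult)
  also have "\<dots> = B i * partial (lab u j) (subtree_poly T (u @ [i]))"
    using sym[of "u @ [i]" i j] ij by (simp add: children_def)
  finally show ?thesis using cancel ij by blast
qed

text \<open>A path that takes the label \<open>\<theta>\<^sub>i\<close> at \<open>u\<close> and \<open>\<theta>\<^sub>j\<close> somewhere below contributes to
  \<open>\<partial>\<^sub>j t(u\<^sub>i)\<close>, hence to \<open>\<partial>\<^sub>i t(u\<^sub>j)\<close>: some path takes \<open>\<theta>\<^sub>j\<close> at \<open>u\<close> and has the same monomial. This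
  is the source of the linear binomials.\<close>

lemma exchange_label_on_path:
  assumes "i \<in> children u" "j \<in> children u" "w \<in> leaves_below (u @ [i])"
    and "lookup (path_exp (u @ [i]) w) (lab u j) \<noteq> 0"
  obtains s where "s \<in> leaves_below (u @ [j])" "path_exp [] s = path_exp [] w"
proof -
  have u: "u \<in> inner T" using assms(1) by (auto simp: inner_iff)
  define m where "m = path_exp (u @ [i]) w - single (lab u j) 1"
  have m: "path_exp (u @ [i]) w = m + single (lab u j) 1"
    unfolding m_def
    by (rule poly_mapping_eqI) (use assms(4) in \<open>auto simp: lookup_add lookup_minus lookup_single when_def\<close>)
  have "path_exp (u @ [i]) w \<in> keys (subtree_poly T (u @ [i]))"
    using assms(3) by (simp add: keys_subtree_poly)
  then have "lookup (partial (lab u j) (subtree_poly T (u @ [i]))) m \<noteq> 0"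
    by (simp add: lookup_partial in_keys_iff m)
  then have "lookup (partial (lab u i) (subtree_poly T (u @ [j]))) m \<noteq> 0"
    using partial_subtree_poly_symmetric[OF u assms(1,2)] by simp
  then have "m + single (lab u i) 1 \<in> keys (subtree_poly T (u @ [j]))"
    by (simp add: lookup_partial in_keys_iff)
  then obtain s where s: "s \<in> leaves_below (u @ [j])" "path_exp (u @ [j]) s = m + single (lab u i) 1"
    by (auto simp: keys_subtree_poly)
  have split: "path_exp [] w = path_exp [] u + (single (lab u k) 1 + path_exp (u @ [k]) w)"
    if "w \<in> leaves_below (u @ [k])" for w k
    using that path_exp_split[of "[]" u w] path_exp_child[of u k w]
    by (auto simp: leaves_below_def dest: append_prefixD)
  have "path_exp [] s = path_exp [] w"
    using split[OF s(1)] split[OF assms(3)] s(2) m by (simp add: algebra_simps)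
  then show ?thesis using that s by blast
qed

end

section \<open>Leaf monomials\<close>

lemma total_degree_superset:
  assumes "finite A" "keys m \<subseteq> A"
  shows "total_degree m = (\<Sum>x\<in>A. lookup m x)"
  unfolding total_degree_def by (rule sum.mono_neutral_left) (use assms in \<open>auto simp: in_keys_iff\<close>)

lemma total_degree_add [simp]: "total_degree (a + b) = total_degree a + total_degree b"
proof -
  let ?A = "keys a \<union> keys b"
  have "total_degree (a + b) = (\<Sum>x\<in>?A. lookup (a + b) x)"
    by (rule total_degree_superset) (use Poly_Mapping.keys_add[of a b] in auto)
  then show ?thesis
    by (simp add: total_degree_superset[of ?A] lookup_add sum.distrib)
qed

lemma total_degree_zero [simp]: "total_degree 0 = 0"
  by (simp add: total_degree_def)

lemma total_degree_single [simp]: "total_degree (single x n) = n"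
  by (simp add: total_degree_def)

lemma total_degree_sum [simp]: "total_degree (\<Sum>i\<in>I. m i) = (\<Sum>i\<in>I. total_degree (m i))"
  by (induction I rule: infinite_finite_induct) auto

lemma single_power: "single m (1::real) ^ n = single (\<Sum>_<n. m) 1"
  by (induction n) (simp_all add: mult_single add.commute)

lemma prod_single: "(\<Prod>i\<in>I. single (m i) (1::real)) = single (\<Sum>i\<in>I. m i) 1"
  by (induction I rule: infinite_finite_induct) (simp_all add: mult_single)

text \<open>The action on exponent vectors of the substitution of the monomial with exponent \<open>E x\<close> for \<open>x\<close>. The
  multiple of \<open>E x\<close> is a repeated sum because the product of finitely supported maps is convolution.\<close>

definition exp_map :: "('x \<Rightarrow> 'y \<Rightarrow>\<^sub>0 nat) \<Rightarrow> ('x \<Rightarrow>\<^sub>0 nat) \<Rightarrow> ('y \<Rightarrow>\<^sub>0 nat)" where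
  "exp_map E m = (\<Sum>x\<in>keys m. \<Sum>_<lookup m x. E x)"

lemma lookup_exp_map:
  assumes "finite A" "keys m \<subseteq> A"
  shows "lookup (exp_map E m) y = (\<Sum>x\<in>A. lookup m x * lookup (E x) y)"
proof -
  have "lookup (exp_map E m) y = (\<Sum>x\<in>keys m. lookup m x * lookup (E x) y)"
    by (simp add: exp_map_def lookup_sum)
  also have "\<dots> = (\<Sum>x\<in>A. lookup m x * lookup (E x) y)"
    by (rule sum.mono_neutral_left) (use assms in \<open>auto simp: in_keys_iff\<close>)
  finally show ?thesis .
qed

lemma exp_map_single: "exp_map E (single x 1) = E x"
  by (simp add: exp_map_def)

lemma exp_map_add: "exp_map E (a + b) = exp_map E a + exp_map E b"
proof (rule poly_mapping_eqI)
  fix y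
  let ?A = "keys a \<union> keys b"
  show "lookup (exp_map E (a + b)) y = lookup (exp_map E a + exp_map E b) y"
    using Poly_Mapping.keys_add[of a b]
    by (simp add: lookup_add lookup_exp_map[of ?A] distrib_right sum.distrib)
qed

lemma poly_subst_monomials:
  assumes "\<And>x. s x = single (E x) 1"
  shows "poly_subst s f = (\<Sum>m\<in>keys f. single (exp_map E m) (lookup f m))"
  by (simp add: poly_subst_def assms single_power prod_single mult_single exp_map_def)

lemma poly_subst_monomials_superset:
  assumes "\<And>x. s x = single (E x) 1" "finite A" "keys f \<subseteq> A"
  shows "poly_subst s f = (\<Sum>m\<in>A. single (exp_map E m) (lookup f m))"
  unfolding poly_subst_monomials[OF assms(1)]
  by (rule sum_keys_superset) (use assms in auto)

lemma eval_poly_subst: "eval_poly P (poly_subst s f) = eval_poly (\<lambda>x. eval_poly P (s x)) f"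
  by (simp add: poly_subst_def eval_poly_def[of _ f] mon_eval_def)

context staged_tree
begin

definition leaf_exp :: "vertex \<Rightarrow> ('l option \<Rightarrow>\<^sub>0 nat)" where
  "leaf_exp w = single None (tree_depth T - length w) +
    (\<Sum>k<length w. single (Some (lab (take k w) (w ! k))) 1)"

lemma path_monomial_eq: "path_monomial T r = single (leaf_exp (leaf T r)) 1"
proof -
  have "(\<Sum>_<n. single (None :: 'l option) (1::nat)) = single None n" for n
    by (induction n) (simp_all flip: single_add)
  then show ?thesis
    unfolding path_monomial_def path_edges_prod
    by (simp add: leaf_exp_def mvar_def single_power prod_single mult_single leaf_depth_def
      card_path_edges atLeast0LessThan)
qed

lemma lookup_leaf_exp_None: "lookup (leaf_exp w) None = tree_depth T - length w"
  by (simp add: leaf_exp_def lookup_add lookup_sum lookup_single)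

lemma lookup_leaf_exp_Some: "lookup (leaf_exp w) (Some x) = lookup (path_exp [] w) x"
  by (simp add: leaf_exp_def path_exp_def lookup_add lookup_sum lookup_single atLeast0LessThan when_def)

lemma total_degree_path_exp: "total_degree (path_exp v w) = length w - length v"
  by (simp add: path_exp_def)

lemma leaf_bij: "bij_betw (leaf T) {1..num_leaves T} (leaves T)"
proof -
  have "bij_betw ((!) (sorted_list_of_set (leaves T))) {..<num_leaves T} (leaves T)"
    by (rule bij_betw_nth) (auto simp: finite_leaves num_leaves_def)
  moreover have "bij_betw (\<lambda>r. r - 1) {1..num_leaves T} {..<num_leaves T}"
    by (rule bij_betw_byWitness[where f' = Suc]) auto
  ultimately have "bij_betw ((!) (sorted_list_of_set (leaves T)) \<circ> (\<lambda>r. r - 1)) {1..num_leaves T} (leaves T)"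
    by (rule bij_betw_trans[rotated])
  also have "(!) (sorted_list_of_set (leaves T)) \<circ> (\<lambda>r. r - 1) = leaf T"
    by (simp add: fun_eq_iff leaf_def)
  finally show ?thesis .
qed

lemma leaf_in_leaves: "r \<in> {1..num_leaves T} \<Longrightarrow> leaf T r \<in> leaves T"
  using leaf_bij by (auto simp: bij_betw_def)

lemma leaf_less_iff:
  assumes "r \<in> {1..num_leaves T}" "s \<in> {1..num_leaves T}"
  shows "leaf T r < leaf T s \<longleftrightarrow> r < s"
proof -
  have mono: "leaf T r < leaf T s" if "r < s" "r \<in> {1..num_leaves T}" "s \<in> {1..num_leaves T}" for r s
    unfolding leaf_def
    by (rule sorted_wrt_nth_less[OF strict_sorted_list_of_set]) (use that in \<open>auto simp: num_leaves_def\<close>)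
  show ?thesis
    using mono[of r s] mono[of s r] assms by (cases r s rule: linorder_cases) auto
qed

lemma leaf_obtain:
  assumes "w \<in> leaves T"
  obtains r where "r \<in> {1..num_leaves T}" "leaf T r = w"
proof -
  have "w \<in> leaf T ` {1..num_leaves T}"
    using leaf_bij assms unfolding bij_betw_def by blast
  then show ?thesis using that by blast
qed

lemma length_leaf_le_tree_depth: "w \<in> leaves T \<Longrightarrow> length w \<le> tree_depth T"
  by (erule leaf_obtain) (auto simp: tree_depth_def leaf_depth_def card_path_edges intro!: Max_ge)

lemma root_inner:
  assumes "verts T \<noteq> {[]}"
  shows "[] \<in> inner T"
proof -
  obtain v where "v \<in> verts T" "v \<noteq> []" using assms root by auto
  then obtain i y where "i # y \<in> verts T" by (cases v) auto
  then have "[i] \<in> verts T" by (rule prefix_in_verts) simp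
  then show ?thesis by (auto simp: inner_iff')
qed

lemma leaf_not_root: "verts T \<noteq> {[]} \<Longrightarrow> w \<in> leaves T \<Longrightarrow> w \<noteq> []"
  using root_inner by (auto simp: leaves_def)

lemma tree_depth_pos:
  assumes "verts T \<noteq> {[]}"
  shows "tree_depth T > 0"
proof -
  have "subtree_poly T [] \<noteq> 0"
    using eval_subtree_poly_pos[OF root, of "\<lambda>_. 1"] by auto
  then have "leaves_below [] \<noteq> {}" by (auto simp: subtree_poly_eq)
  then obtain w where w: "w \<in> leaves T" by (auto simp: leaves_below_def)
  then show ?thesis
    using length_leaf_le_tree_depth[OF w] leaf_not_root[OF assms w] by (cases w) auto
qed

lemma total_degree_leaf_exp: "w \<in> leaves T \<Longrightarrow> total_degree (leaf_exp w) = tree_depth T"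
  using length_leaf_le_tree_depth by (simp add: leaf_exp_def)

text \<open>The depth of a leaf is the total degree of its label monomial, so equality of the label
  monomials carries over to the powers of \<open>z\<close>; likewise for products of two leaf monomials below.\<close>

lemma leaf_exp_eqI:
  assumes "path_exp [] w = path_exp [] s"
  shows "leaf_exp w = leaf_exp s"
proof (rule poly_mapping_eqI)
  fix y
  have "length w = length s"
    using arg_cong[OF assms, of total_degree] by (simp add: total_degree_path_exp)
  then show "lookup (leaf_exp w) y = lookup (leaf_exp s) y"
    using assms by (cases y) (auto simp: lookup_leaf_exp_None lookup_leaf_exp_Some)
qed

lemma leaf_exp_add_eqI:
  assumes "path_exp [] w1 + path_exp [] w2 = path_exp [] s1 + path_exp [] s2"
    and "w1 \<in> leaves T" "w2 \<in> leaves T" "s1 \<in> leaves T" "s2 \<in> leaves T"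
  shows "leaf_exp w1 + leaf_exp w2 = leaf_exp s1 + leaf_exp s2"
proof (rule poly_mapping_eqI)
  fix y
  have "length w1 + length w2 = length s1 + length s2"
    using arg_cong[OF assms(1), of total_degree] by (simp add: total_degree_path_exp)
  then show "lookup (leaf_exp w1 + leaf_exp w2) y = lookup (leaf_exp s1 + leaf_exp s2) y"
    using arg_cong[OF assms(1), of "\<lambda>m. lookup m (the y)"] assms(2-)[THEN length_leaf_le_tree_depth]
    by (cases y) (auto simp: lookup_add lookup_leaf_exp_None lookup_leaf_exp_Some)
qed

end

section \<open>Polynomial rings and their ideals\<close>

lemma keys_add_mono: "keys a \<subseteq> X \<Longrightarrow> keys b \<subseteq> X \<Longrightarrow> keys (a + b) \<subseteq> X"
  using Poly_Mapping.keys_add[of a b] by blast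

lemma poly_ring_simps [simp]:
  "mult (poly_ring X) = (*)" "one (poly_ring X) = 1" "zero (poly_ring X) = 0" "add (poly_ring X) = (+)"
  by (simp_all add: poly_ring_def)

lemma carrier_poly_ring: "f \<in> carrier (poly_ring X) \<longleftrightarrow> (\<forall>m\<in>keys f. keys m \<subseteq> X)"
  by (simp add: poly_ring_def)

lemma single_in_carrier: "keys m \<subseteq> X \<Longrightarrow> single m c \<in> carrier (poly_ring X)"
  by (simp add: carrier_poly_ring)

lemma add_in_carrier:
  "f \<in> carrier (poly_ring X) \<Longrightarrow> g \<in> carrier (poly_ring X) \<Longrightarrow> f + g \<in> carrier (poly_ring X)"
  using Poly_Mapping.keys_add[of f g] unfolding carrier_poly_ring by blast

lemma uminus_in_carrier: "f \<in> carrier (poly_ring X) \<Longrightarrow> - f \<in> carrier (poly_ring X)"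
  by (simp add: carrier_poly_ring in_keys_iff)

lemma mult_in_carrier:
  assumes "f \<in> carrier (poly_ring X)" "g \<in> carrier (poly_ring X)"
  shows "f * g \<in> carrier (poly_ring X)"
  unfolding carrier_poly_ring
proof
  fix m assume "m \<in> keys (f * g)"
  with keys_mult[of f g] obtain a b where "m = a + b" "a \<in> keys f" "b \<in> keys g" by blast
  moreover from this have "keys a \<subseteq> X" "keys b \<subseteq> X"
    using assms by (simp_all add: carrier_poly_ring)
  ultimately show "keys m \<subseteq> X" by (simp add: keys_add_mono)
qed

lemma ring_poly_ring: "ring (poly_ring X)"
proof (rule ringI)
  show "abelian_group (poly_ring X)"
  proof (rule abelian_groupI)
    fix f assume f: "f \<in> carrier (poly_ring X)"
    show "\<exists>g\<in>carrier (poly_ring X). g \<oplus>\<^bsub>poly_ring X\<^esub> f = \<zero>\<^bsub>poly_ring X\<^esub>"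
      by (rule bexI[of _ "- f"]) (use f uminus_in_carrier in auto)
  qed (auto simp: add_in_carrier carrier_poly_ring[of 0] algebra_simps)
  show "monoid (poly_ring X)"
    by (rule monoidI) (auto simp: mult_in_carrier carrier_poly_ring[of 1] algebra_simps)
qed (simp_all add: distrib_left distrib_right)

lemma inv_add_poly_ring:
  assumes "f \<in> carrier (poly_ring X)"
  shows "inv\<^bsub>add_monoid (poly_ring X)\<^esub> f = - f"
proof -
  interpret ring "poly_ring X" by (rule ring_poly_ring)
  show ?thesis
    using minus_equality[of "- f" f] assms uminus_in_carrier[OF assms] unfolding a_inv_def by simp
qed

lemma ideal_poly_ringI:
  assumes "I \<subseteq> carrier (poly_ring X)" "0 \<in> I"
    and "\<And>f g. f \<in> I \<Longrightarrow> g \<in> I \<Longrightarrow> f + g \<in> I"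
    and "\<And>f g. f \<in> I \<Longrightarrow> g \<in> carrier (poly_ring X) \<Longrightarrow> g * f \<in> I"
  shows "ideal I (poly_ring X)"
proof (rule idealI[OF ring_poly_ring])
  have m1: "- 1 \<in> carrier (poly_ring X)"
    by (intro uminus_in_carrier) (simp add: carrier_poly_ring)
  show "subgroup I (add_monoid (poly_ring X))"
  proof (rule subgroup.intro)
    fix f assume f: "f \<in> I"
    then have "inv\<^bsub>add_monoid (poly_ring X)\<^esub> f = - 1 * f"
      using inv_add_poly_ring assms(1) by auto
    then show "inv\<^bsub>add_monoid (poly_ring X)\<^esub> f \<in> I"
      using assms(4)[OF f m1] by simp
  qed (use assms in auto)
qed (use assms in \<open>auto simp: mult.commute\<close>)

section \<open>The kernel of the toric map\<close>

context balanced_staged_tree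
begin

lemma sum_to_z_ideal_vanishes:
  assumes "f \<in> sum_to_z_ideal T"
    and "\<And>v. v \<in> inner T \<Longrightarrow> (\<Sum>i\<in>children v. Q (Some (lab v i))) = Q None"
  shows "eval_poly Q f = 0"
proof -
  let ?X = "insert None (Some ` labels T)"
  let ?I = "{f \<in> carrier (poly_ring ?X). eval_poly Q f = 0}"
  interpret ring "poly_ring ?X" by (rule ring_poly_ring)
  have "sum_to_z_ideal T \<subseteq> ?I"
    unfolding sum_to_z_ideal_def
  proof (rule genideal_minimal)
    show "ideal ?I (poly_ring ?X)"
      by (rule ideal_poly_ringI) (auto simp: add_in_carrier mult_in_carrier carrier_poly_ring[of 0])
    show "{(\<Sum>e\<in>out_edges T v. mvar (Some (label T e))) - mvar None |v. v \<in> inner T} \<subseteq> ?I"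
    proof safe
      fix v assume v: "v \<in> inner T"
      have mv: "mvar x \<in> carrier (poly_ring ?X)" if "x \<in> ?X" for x
        using that by (simp add: mvar_def single_in_carrier)
      have "(\<Sum>e\<in>E. mvar (Some (label T e))) \<in> carrier (poly_ring ?X)" if "E \<subseteq> out_edges T v" for E
        using that
      proof (induction E rule: infinite_finite_induct)
        case (insert e E)
        then have "Some (label T e) \<in> ?X" using v by (auto simp: labels_def inner_def)
        then show ?case using insert by (auto intro!: add_in_carrier mv)
      qed (auto simp: carrier_poly_ring)
      then show "(\<Sum>e\<in>out_edges T v. mvar (Some (label T e))) - mvar None \<in> carrier (poly_ring ?X)"
        unfolding diff_conv_add_uminus by (intro add_in_carrier uminus_in_carrier mv) auto
      have "inj_on (\<lambda>i. (v, v @ [i])) (children v)" by (auto simp: inj_on_def)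
      then show "eval_poly Q ((\<Sum>e\<in>out_edges T v. mvar (Some (label T e))) - mvar None) = 0"
        using assms(2)[OF v] by (simp add: out_edges_eq sum.reindex)
    qed
  qed
  with assms(1) show ?thesis by auto
qed

lemma eval_path_monomial:
  "eval_poly P (path_monomial T r) = P None ^ (tree_depth T - length (leaf T r)) *
    (\<Prod>k<length (leaf T r). P (Some (lab (take k (leaf T r)) (leaf T r ! k))))"
  by (simp add: path_monomial_def path_edges_prod leaf_depth_def card_path_edges atLeast0LessThan)

text \<open>Given arbitrary positive labels, divide each by \<open>z\<close> and let \<open>t(v)\<close> be the resulting values
  of the subtree polynomials. The new label \<open>\<theta>\<^sub>i t(v\<^sub>i) / t(v)\<close> on the edge from \<open>v\<close> to \<open>v\<^sub>i\<close> depends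
  only on the stage of \<open>v\<close>, by balancedness, and the new labels at \<open>v\<close> sum to one. Along a
  root-to-leaf path the factors telescope to \<open>1 / t(root)\<close>. Multiplying the new labels and \<open>z = 1\<close> by a
  suitable \<open>d\<close>-th root compensates this factor and the initial division, because all leaf monomials have degree \<open>d\<close>.\<close>

lemma reparametrization:
  fixes P :: "'l option \<Rightarrow> real"
  assumes "\<And>x. P x > 0" "verts T \<noteq> {[]}"
  shows "\<exists>Q. (\<forall>v\<in>inner T. (\<Sum>i\<in>children v. Q (Some (lab v i))) = Q None) \<and>
    (\<forall>r\<in>{1..num_leaves T}. eval_poly Q (path_monomial T r) = eval_poly P (path_monomial T r))"
proof -
  define q where "q x = P (Some x) / P None" for x
  define t where "t v = eval_poly q (subtree_poly T v)" for v
  \<comment> \<open>The new value of the label \<open>x\<close>, read off at some edge that carries it.\<close>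
  define rho where "rho x = (SOME y. \<exists>v i. v @ [i] \<in> verts T \<and> lab v i = x \<and> y = q x * t (v @ [i]) / t v)" for x
  have q: "q x > 0" for x using assms by (simp add: q_def)
  have t: "t v > 0" if "v \<in> verts T" for v
    unfolding t_def by (rule eval_subtree_poly_pos) (use that q in auto)
  have t_inner: "t v = (\<Sum>i\<in>children v. q (lab v i) * t (v @ [i]))" if "v \<in> inner T" for v
    by (simp add: t_def subtree_poly_inner[OF that])
  have rho: "rho (lab v i) = q (lab v i) * t (v @ [i]) / t v" if vi: "v @ [i] \<in> verts T" for v i
  proof -
    have "\<exists>v' i'. v' @ [i'] \<in> verts T \<and> lab v' i' = lab v i \<and> rho (lab v i) = q (lab v i) * t (v' @ [i']) / t v'"
      unfolding rho_def by (rule someI_ex) (use vi in blast)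
    then obtain v' i' where v': "v' @ [i'] \<in> verts T" "lab v' i' = lab v i"
      "rho (lab v i) = q (lab v i) * t (v' @ [i']) / t v'" by blast
    have st: "(v', v) \<in> stage T" "i' = i"
      using label_eq_imp_same_stage[OF v'(1) vi v'(2)] by auto
    have inner: "v \<in> inner T" "v' \<in> inner T" using vi v' by (auto simp: inner_iff')
    have i: "i \<in> children v'" using v' st by (simp add: children_def)
    \<comment> \<open>Independence of the edge: \<open>t(v'\<^sub>i) / t(v') = t(v\<^sub>i) / t(v)\<close> for \<open>v' \<sim> v\<close>.\<close>
    have "t (v' @ [i]) * t v = (\<Sum>j\<in>children v'. q (lab v' j) * (t (v' @ [i]) * t (v @ [j])))"
      unfolding t_inner[OF inner(1)] stage_children(1)[OF st(1), symmetric] sum_distrib_left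
      by (rule sum.cong) (use stage_children(2)[OF st(1)] in auto)
    also have "\<dots> = (\<Sum>j\<in>children v'. q (lab v' j) * (t (v' @ [j]) * t (v @ [i])))"
    proof (rule sum.cong)
      fix j assume "j \<in> children v'"
      from arg_cong[OF balanced_eq[OF st(1) i this], of "eval_poly q"]
      show "q (lab v' j) * (t (v' @ [i]) * t (v @ [j])) = q (lab v' j) * (t (v' @ [j]) * t (v @ [i]))"
        by (simp add: t_def)
    qed simp
    also have "\<dots> = t v' * t (v @ [i])"
      by (simp add: t_inner[OF inner(2)] sum_distrib_right mult.assoc)
    finally have "t (v' @ [i]) / t v' = t (v @ [i]) / t v"
      using t[of v] t[of v'] inner by (simp add: inner_def field_simps)
    then show ?thesis using v'(3) st by (metis times_divide_eq_right)
  qed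
  have rho_path: "(\<Prod>k<n. rho (lab (take k w) (w ! k))) = (\<Prod>k<n. q (lab (take k w) (w ! k))) * t (take n w) / t []"
    if "w \<in> verts T" "n \<le> length w" for w n
    using that(2)
  proof (induction n)
    case 0
    show ?case using t[OF root] by simp
  next
    case (Suc n)
    then have tk: "take (Suc n) w = take n w @ [w ! n]" by (simp add: take_Suc_conv_app_nth)
    have "prefix (take (Suc n) w) w" "prefix (take n w) w" by (auto simp: take_is_prefix)
    then have "take n w @ [w ! n] \<in> verts T" "take n w \<in> verts T"
      using prefix_in_verts that(1) tk by metis+
    then show ?case
      using Suc t[of "take n w"] rho[of "take n w" "w ! n"] by (simp add: tk)
  qed
  have d: "tree_depth T > 0" by (rule tree_depth_pos[OF assms(2)])
  define c where "c = root (tree_depth T) (P None ^ tree_depth T * t [])"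
  have c: "c ^ tree_depth T = P None ^ tree_depth T * t []"
    unfolding c_def by (rule real_root_pow_pos) (use d t[OF root] assms in auto)
  define Q where "Q = (\<lambda>y. case y of None \<Rightarrow> c | Some x \<Rightarrow> c * rho x)"
  show ?thesis
  proof (intro exI[of _ Q] conjI ballI)
    fix v assume v: "v \<in> inner T"
    have "(\<Sum>i\<in>children v. Q (Some (lab v i))) = (\<Sum>i\<in>children v. c * (q (lab v i) * t (v @ [i]) / t v))"
      by (rule sum.cong) (auto simp: Q_def rho children_def)
    also have "\<dots> = c * (t v / t v)"
      using t_inner[OF v] by (simp flip: sum_distrib_left sum_divide_distrib)
    also have "\<dots> = Q None" using t[of v] v by (simp add: Q_def inner_def)
    finally show "(\<Sum>i\<in>children v. Q (Some (lab v i))) = Q None" .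
  next
    fix r assume r: "r \<in> {1..num_leaves T}"
    define w where "w = leaf T r"
    have w: "w \<in> leaves T" using r leaf_in_leaves by (simp add: w_def)
    have len: "tree_depth T - length w + length w = tree_depth T"
      using length_leaf_le_tree_depth[OF w] by simp
    have tw: "t w = 1" by (simp add: t_def subtree_poly_leaf[OF w])
    have "eval_poly Q (path_monomial T r) = c ^ (tree_depth T - length w + length w) * (\<Prod>k<length w. rho (lab (take k w) (w ! k)))"
      by (simp add: eval_path_monomial Q_def prod.distrib power_add flip: w_def)
    also have "\<dots> = P None ^ tree_depth T * (\<Prod>k<length w. q (lab (take k w) (w ! k)))"
      using rho_path[of w "length w"] leaf_in_verts[OF w] t[OF root] tw by (simp add: len c)
    also have "\<dots> = P None ^ (tree_depth T - length w) * (P None ^ length w * (\<Prod>k<length w. q (lab (take k w) (w ! k))))"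
      unfolding mult.assoc[symmetric] power_add[symmetric] len ..
    also have "P None ^ length w * (\<Prod>k<length w. q (lab (take k w) (w ! k))) =
        (\<Prod>k<length w. P (Some (lab (take k w) (w ! k))))"
      using assms(1)[of None] by (simp add: q_def prod_dividef)
    finally show "eval_poly Q (path_monomial T r) = eval_poly P (path_monomial T r)"
      by (simp add: eval_path_monomial flip: w_def)
  qed
qed

lemma coset_eq_imp_mem:
  assumes "sum_to_z_ideal T +>\<^bsub>target_ring T\<^esub> g = sum_to_z_ideal T"
  shows "g \<in> sum_to_z_ideal T"
proof -
  interpret ring "target_ring T" by (rule ring_poly_ring)
  have "0 \<in> sum_to_z_ideal T"
    unfolding sum_to_z_ideal_def genideal_def
    by (auto dest: additive_subgroup.zero_closed[OF ideal.axioms(1)])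
  then have "0 + g \<in> sum_to_z_ideal T +>\<^bsub>target_ring T\<^esub> g"
    by (auto simp: a_r_coset_def r_coset_def)
  then show ?thesis using assms by simp
qed

text \<open>The nontrivial inclusion between the kernel of \<open>phi\<close> and that of the monomial map: by the
  reparametrization, every value that the leaf monomials take at a positive point is also taken at a
  point where the generators of \<open>\<langle>\<theta> - z\<rangle>\<close> vanish. So the image of \<open>f\<close> under the monomial map
  vanishes at all positive points.\<close>

lemma ker_phi_imp_subst_eq_zero:
  assumes "f \<in> ker_phi T" "verts T \<noteq> {[]}"
  shows "f \<in> carrier (source_ring T)" "poly_subst (path_monomial T) f = 0"
proof -
  show f: "f \<in> carrier (source_ring T)"
    using assms(1) by (simp add: ker_phi_def a_kernel_def')
  have "phi T f = sum_to_z_ideal T"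
    using assms(1) by (simp add: ker_phi_def a_kernel_def' FactRing_def)
  then have mem: "poly_subst (path_monomial T) f \<in> sum_to_z_ideal T"
    by (intro coset_eq_imp_mem) (simp add: phi_def)
  show "poly_subst (path_monomial T) f = 0"
  proof (rule eval_poly_eq_zero_imp_eq_zero)
    fix P :: "'l option \<Rightarrow> real" assume P: "\<And>x. P x > 0"
    obtain Q where Q: "\<forall>v\<in>inner T. (\<Sum>i\<in>children v. Q (Some (lab v i))) = Q None"
      "\<forall>r\<in>{1..num_leaves T}. eval_poly Q (path_monomial T r) = eval_poly P (path_monomial T r)"
      using reparametrization[of P, OF P assms(2)] by blast
    have "eval_poly P (poly_subst (path_monomial T) f) = eval_poly Q (poly_subst (path_monomial T) f)"
      unfolding eval_poly_subst eval_poly_def[of _ f]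
    proof (rule sum.cong[OF refl])
      fix m assume "m \<in> keys f"
      then have "keys m \<subseteq> {1..num_leaves T}" using f by (simp add: carrier_poly_ring)
      then show "lookup f m * mon_eval (\<lambda>x. eval_poly P (path_monomial T x)) m =
          lookup f m * mon_eval (\<lambda>x. eval_poly Q (path_monomial T x)) m"
        using Q(2) by (auto simp: mon_eval_def intro!: prod.cong)
    qed
    also have "\<dots> = 0" by (rule sum_to_z_ideal_vanishes[OF mem]) (use Q(1) in blast)
    finally show "eval_poly P (poly_subst (path_monomial T) f) = 0" .
  qed
qed

lemma subst_eq_zero_imp_ker_phi:
  assumes "f \<in> carrier (source_ring T)" "poly_subst (path_monomial T) f = 0"
  shows "f \<in> ker_phi T"
  using assms by (simp add: ker_phi_def a_kernel_def' FactRing_def phi_def a_r_coset_def r_coset_def)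

end

section \<open>The combinatorial core\<close>

lemma less_imp_branch:
  fixes w x :: "nat list"
  assumes "w < x" "\<not> prefix w x"
  shows "\<exists>i j. i < j \<and> prefix (longest_common_prefix w x @ [i]) w \<and> prefix (longest_common_prefix w x @ [j]) x"
  using assms by (induction w x rule: longest_common_prefix.induct) (auto split: if_splits)

lemma branch_imp_less:
  fixes w x :: "nat list"
  assumes "prefix (u @ [i]) w" "prefix (u @ [j]) x" "i < j"
  shows "w < x"
proof -
  from assms obtain y z where "w = u @ i # y" "x = u @ j # z" by (auto simp: prefix_def)
  then show ?thesis using assms(3) by (induction u arbitrary: w x) auto
qed

lemma (in staged_tree) path_exp_through:
  assumes "prefix (u @ [i]) w"
  shows "path_exp [] w = path_exp [] u + (single (lab u i) 1 + path_exp (u @ [i]) w)"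
  using assms path_exp_split[of "[]" u w] path_exp_child[of u i w] by (auto dest: append_prefixD)

lemma (in staged_tree) leaf_branch:
  assumes "w \<in> leaves T" "x \<in> leaves T" "w < x"
  obtains i j where "i < j" "prefix (longest_common_prefix w x @ [i]) w"
    "prefix (longest_common_prefix w x @ [j]) x"
proof -
  have "\<not> prefix w x"
    using leaf_prefix_imp_eq[OF assms(1) leaf_in_verts[OF assms(2)]] assms(3) by auto
  then show ?thesis using less_imp_branch[OF assms(3)] that by blast
qed

context balanced_staged_tree
begin

abbreviation "rexp r \<equiv> leaf_exp (leaf T r)"

text \<open>The monomials \<open>p^a\<close> and \<open>p^b\<close> have the same image, and all leaves of \<open>p^a\<close> lie above the leaf \<open>l\<close>
  of \<open>p^b\<close>. Let \<open>r\<close> be a leaf of \<open>p^a\<close> whose path follows that of \<open>l\<close> as long as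
  possible, say down to \<open>u\<close>, where it continues to \<open>u\<^sub>i\<close> and the path of \<open>l\<close> to \<open>u\<^sub>j\<close>; then
  \<open>i < j\<close>. Since the images agree, the label \<open>\<theta>\<^sub>j\<close> of that edge occurs on the path of some leaf
  \<open>r\<^sub>2\<close> of \<open>p^a\<close>, at an edge from \<open>v\<close> to \<open>v\<^sub>j\<close> with \<open>u \<sim> v\<close>. If \<open>p\<^sub>r p\<^sub>r\<^sub>2\<close> divides \<open>p^a\<close>, the two
  paths can be swapped, and the new leaf below \<open>u\<^sub>j\<close> is below \<open>r\<close> and, by the choice of \<open>r\<close>, also
  below \<open>r\<^sub>2\<close>. Otherwise all the labels \<open>\<theta>\<^sub>j\<close> in \<open>p^a\<close> lie on the one path of \<open>r\<close>; as there are at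
  least as many as on the path of \<open>l\<close>, which has more than the common part down to \<open>u\<close>, one of
  them lies below \<open>u\<^sub>i\<close>, and it can be exchanged with
  the label \<open>\<theta>\<^sub>i\<close> at \<open>u\<close>.\<close>

lemma bottom_leaf_reduction:
  fixes a b :: "nat \<Rightarrow> nat"
  assumes nontrivial: "verts T \<noteq> {[]}"
    and same: "\<And>y. (\<Sum>r\<in>{1..num_leaves T}. a r * lookup (rexp r) y) = (\<Sum>r\<in>{1..num_leaves T}. b r * lookup (rexp r) y)"
    and l: "l \<in> {1..num_leaves T}" "b l > 0"
    and above: "\<forall>r\<in>{l..num_leaves T}. a r = 0"
  shows "(\<exists>r\<in>{1..num_leaves T}. \<exists>s\<in>{1..num_leaves T}. r < s \<and> a r > 0 \<and> rexp r = rexp s) \<or>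
    (\<exists>r1\<in>{1..num_leaves T}. \<exists>r2\<in>{1..num_leaves T}. \<exists>s1\<in>{1..num_leaves T}. \<exists>s2\<in>{1..num_leaves T}.
      r1 < s1 \<and> r2 < s1 \<and> rexp r1 + rexp r2 = rexp s1 + rexp s2 \<and>
      (\<forall>x. lookup (single r1 1 + single r2 (1::nat)) x \<le> a x) \<and>
      (\<exists>u v i j. (u, v) \<in> stage T \<and>
         prefix (u @ [i]) (leaf T r1) \<and> prefix (v @ [j]) (leaf T r2) \<and>
         prefix (u @ [j]) (leaf T s1) \<and> prefix (v @ [i]) (leaf T s2)))"
    (is "?linear \<or> ?quadratic")
proof -
  let ?R = "{1..num_leaves T}"
  define x where "x = leaf T l"
  define A where "A = {r \<in> ?R. a r > 0}"
  have x: "x \<in> leaves T" using l leaf_in_leaves by (simp add: x_def)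
  have A: "r \<in> ?R" "leaf T r \<in> leaves T" "leaf T r < x" if "r \<in> A" for r
  proof -
    show r: "r \<in> ?R" "leaf T r \<in> leaves T" using that leaf_in_leaves by (auto simp: A_def)
    have "r < l"
    proof (rule ccontr)
      assume "\<not> r < l"
      then have "a r = 0" using above r(1) by simp
      with that show False by (simp add: A_def)
    qed
    then show "leaf T r < x" using r l leaf_less_iff by (simp add: x_def)
  qed
  have same': "(\<Sum>r\<in>?R. a r * lookup (path_exp [] (leaf T r)) t) = (\<Sum>r\<in>?R. b r * lookup (path_exp [] (leaf T r)) t)" for t
    using same[of "Some t"] by (simp add: lookup_leaf_exp_Some)
  have b_ge: "lookup (path_exp [] x) t \<le> (\<Sum>r\<in>?R. a r * lookup (path_exp [] (leaf T r)) t)" for t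
  proof -
    have "lookup (path_exp [] x) t \<le> b l * lookup (path_exp [] (leaf T l)) t"
      using l by (simp add: x_def)
    also have "\<dots> \<le> (\<Sum>r\<in>?R. b r * lookup (path_exp [] (leaf T r)) t)"
      by (rule member_le_sum) (use l in auto)
    finally show ?thesis unfolding same' .
  qed
  have occ: "\<exists>r\<in>A. lookup (path_exp [] (leaf T r)) t \<noteq> 0" if "lookup (path_exp [] x) t \<noteq> 0" for t
  proof (rule ccontr)
    assume "\<not> ?thesis"
    then have "(\<Sum>r\<in>?R. a r * lookup (path_exp [] (leaf T r)) t) = 0"
      by (auto simp: A_def)
    with b_ge[of t] that show False by linarith
  qed
  have "A \<noteq> {}"
  proof -
    obtain i y where iy: "x = i # y" using leaf_not_root[OF nontrivial x] by (cases x) auto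
    have "lookup (path_exp [] x) (lab [] i) \<noteq> 0"
      using path_exp_through[of "[]" i x] by (simp add: iy lookup_add)
    then show ?thesis using occ by blast
  qed
  define lcp where "lcp r = longest_common_prefix (leaf T r) x" for r
  have finA: "finite A" by (simp add: A_def)
  have "Max ((\<lambda>r. length (lcp r)) ` A) \<in> (\<lambda>r. length (lcp r)) ` A"
    by (rule Max_in) (use finA \<open>A \<noteq> {}\<close> in auto)
  then obtain r where r: "r \<in> A" and r_max: "length (lcp r) = Max ((\<lambda>r. length (lcp r)) ` A)" by auto
  have longest: "length (lcp r') \<le> length (lcp r)" if "r' \<in> A" for r'
    unfolding r_max by (rule Max_ge) (use finA that in auto)
  define u where "u = lcp r"
  obtain i j where ij: "i < j" "prefix (u @ [i]) (leaf T r)" "prefix (u @ [j]) x"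
    using leaf_branch[OF A(2)[OF r] x A(3)[OF r]] by (auto simp: u_def lcp_def)
  have ch: "i \<in> children u" "j \<in> children u"
    using prefix_in_verts[OF leaf_in_verts] ij(2,3) A(2)[OF r] x by (auto simp: children_def)
  have lab_ne: "lab u i \<noteq> lab u j"
    using label_eq_imp_same_stage(2)[of u i u j] ch ij(1) by (auto simp: children_def)
  let ?t = "lab u j"
  have x_t: "lookup (path_exp [] x) ?t \<ge> lookup (path_exp [] u) ?t + 1"
    using path_exp_through[OF ij(3)] by (simp add: lookup_add)
  show ?thesis
  proof (cases "\<exists>r2\<in>A. lookup (path_exp [] (leaf T r2)) ?t \<noteq> 0 \<and> (r2 = r \<longrightarrow> a r \<ge> 2)")
    case True
    then obtain r2 where r2: "r2 \<in> A" "lookup (path_exp [] (leaf T r2)) ?t \<noteq> 0" "r2 = r \<longrightarrow> a r \<ge> 2"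
      by blast
    obtain k where k: "take k (leaf T r2) @ [leaf T r2 ! k] \<in> verts T"
      "prefix (take k (leaf T r2) @ [leaf T r2 ! k]) (leaf T r2)"
      "lab (take k (leaf T r2)) (leaf T r2 ! k) = ?t"
      using lookup_path_exp_pos_imp_edge[OF r2(2) leaf_in_verts[OF A(2)[OF r2(1)]]] by blast
    define v where "v = take k (leaf T r2)"
    have uj: "u @ [j] \<in> verts T" using ch by (simp add: children_def)
    have st: "(u, v) \<in> stage T" and kj: "leaf T r2 ! k = j"
      using label_eq_imp_same_stage[OF uj k(1)] k(3) by (auto simp: v_def)
    have r2v: "prefix (v @ [j]) (leaf T r2)" using k(2) by (simp add: v_def kj)
    obtain w1 w2 where w: "w1 \<in> leaves_below (u @ [j])" "w2 \<in> leaves_below (v @ [i])"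
      "path_exp [] (leaf T r) + path_exp [] (leaf T r2) = path_exp [] w1 + path_exp [] w2"
      using swap_paths[OF st ch, of "leaf T r" "leaf T r2"] ij(2) r2v A(2) r r2(1)
      by (auto simp: leaves_below_def)
    have wl: "w1 \<in> leaves T" "w2 \<in> leaves T" using w by (auto simp: leaves_below_def)
    obtain s1 s2 where s: "s1 \<in> ?R" "leaf T s1 = w1" "s2 \<in> ?R" "leaf T s2 = w2"
      using leaf_obtain wl by metis
    have w1: "prefix (u @ [j]) w1" using w by (simp add: leaves_below_def)
    have "leaf T r < w1" by (rule branch_imp_less[OF ij(2) w1 ij(1)])
    moreover have "leaf T r2 < w1"
    proof -
      obtain i' j' where b: "i' < j'" "prefix (lcp r2 @ [i']) (leaf T r2)" "prefix (lcp r2 @ [j']) x"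
        using leaf_branch[OF A(2)[OF r2(1)] x A(3)[OF r2(1)]] by (auto simp: lcp_def)
      \<comment> \<open>The path of \<open>r2\<close> leaves that of \<open>l\<close> at \<open>u\<close> or above, hence above all of the subtree at \<open>u\<^sub>j\<close>.\<close>
      have "prefix (lcp r2 @ [j']) (u @ [j])"
        by (rule prefix_length_prefix[OF b(3) ij(3)]) (use longest[OF r2(1)] in \<open>simp add: u_def\<close>)
      then have "prefix (lcp r2 @ [j']) w1" using w1 by (rule prefix_order.trans)
      then show ?thesis using branch_imp_less[OF b(2) _ b(1)] by blast
    qed
    ultimately have less: "r < s1" "r2 < s1"
      using leaf_less_iff A(1) r r2(1) s by auto
    have "rexp r + rexp r2 = rexp s1 + rexp s2"
      using leaf_exp_add_eqI[OF w(3)] A(2) r r2(1) wl s by simp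
    moreover have "\<forall>x. lookup (single r 1 + single r2 (1::nat)) x \<le> a x"
      using r r2 by (auto simp: A_def lookup_add lookup_single when_def)
    moreover have "prefix (v @ [i]) (leaf T s2)" "prefix (u @ [j]) (leaf T s1)"
      using w s by (auto simp: leaves_below_def)
    ultimately have ?quadratic
      using less st ij(2) r2v A(1)[OF r] A(1)[OF r2(1)] s by blast
    then show ?thesis ..
  next
    case False
    have occ_t: "\<exists>r2\<in>A. lookup (path_exp [] (leaf T r2)) ?t \<noteq> 0"
      using occ x_t by force
    with False have ar: "a r = 1" using r by (force simp: A_def)
    \<comment> \<open>Only the path of \<open>r\<close>, with multiplicity one, contains the label \<open>\<theta>\<^sub>j\<close>.\<close>
    have "(\<Sum>r'\<in>?R. a r' * lookup (path_exp [] (leaf T r')) ?t)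
        = (\<Sum>r'\<in>?R. if r' = r then lookup (path_exp [] (leaf T r)) ?t else 0)"
      by (rule sum.cong) (use False ar in \<open>auto simp: A_def\<close>)
    also have "\<dots> = lookup (path_exp [] (leaf T r)) ?t"
      using A(1)[OF r] by simp
    finally have "lookup (path_exp [] u) ?t + 1 \<le> lookup (path_exp [] (leaf T r)) ?t"
      using b_ge[of ?t] x_t by simp
    then have "lookup (path_exp (u @ [i]) (leaf T r)) ?t \<noteq> 0"
      using path_exp_through[OF ij(2)] lab_ne by (simp add: lookup_add lookup_single)
    moreover have "leaf T r \<in> leaves_below (u @ [i])"
      using ij(2) A(2)[OF r] by (simp add: leaves_below_def)
    ultimately obtain w where w: "w \<in> leaves_below (u @ [j])" "path_exp [] w = path_exp [] (leaf T r)"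
      using exchange_label_on_path[OF ch] by blast
    then obtain s where s: "s \<in> ?R" "leaf T s = w"
      using leaf_obtain by (auto simp: leaves_below_def)
    have "leaf T r < w"
      by (rule branch_imp_less[OF ij(2) _ ij(1)]) (use w in \<open>simp add: leaves_below_def\<close>)
    then have "r < s" using leaf_less_iff[OF A(1)[OF r] s(1)] s(2) by simp
    moreover have "rexp r = rexp s" using leaf_exp_eqI w(2) s by metis
    ultimately have ?linear using A(1)[OF r] s(1) ar by (intro bexI[of _ r] bexI[of _ s]) auto
    then show ?thesis ..
  qed
qed

end

section \<open>The degree reverse lexicographic order\<close>

lemma degrevlex_gt_eq_degreeI:
  assumes "total_degree a = total_degree b" "\<And>k. k \<ge> s \<Longrightarrow> lookup a k = 0" "lookup b s > 0"
  shows "degrevlex_gt a b"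
proof -
  let ?D = "{k. lookup b k \<noteq> 0 \<and> k \<ge> s}"
  have fin: "finite ?D"
    by (rule finite_subset[of _ "keys b"]) (auto simp: in_keys_iff)
  have ne: "?D \<noteq> {}" using assms(3) by auto
  define i where "i = Max ?D"
  have i: "lookup b i \<noteq> 0" "i \<ge> s" using Max_in[OF fin ne] by (auto simp: i_def)
  have "lookup b k = 0" if "k > i" for k
  proof (rule ccontr)
    assume "lookup b k \<noteq> 0"
    then have "k \<le> i" using Max_ge[OF fin, of k] that i(2) by (simp add: i_def)
    with that show False by simp
  qed
  then have "\<forall>k>i. lookup a k = lookup b k" using assms(2) i by auto
  moreover have "lookup a i < lookup b i" using i assms(2) by simp
  ultimately show ?thesis using assms(1) by (auto simp: degrevlex_gt_def)
qed

lemma degrevlex_gt_irrefl: "\<not> degrevlex_gt a a"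
  by (simp add: degrevlex_gt_def)

lemma degrevlex_gt_trans:
  assumes "degrevlex_gt a b" "degrevlex_gt b c"
  shows "degrevlex_gt a c"
proof (cases "total_degree a = total_degree b \<and> total_degree b = total_degree c")
  case True
  obtain i where i: "lookup a i < lookup b i" "\<forall>k>i. lookup a k = lookup b k"
    using assms(1) True by (auto simp: degrevlex_gt_def)
  obtain j where j: "lookup b j < lookup c j" "\<forall>k>j. lookup b k = lookup c k"
    using assms(2) True by (auto simp: degrevlex_gt_def)
  have "lookup a (max i j) < lookup c (max i j)"
  proof (cases i j rule: linorder_cases)
    case less
    then have "lookup a j = lookup b j" using i(2) by blast
    then show ?thesis using less j(1) by (simp add: max_def)
  next
    case equal
    then show ?thesis using i(1) j(1) by simp
  next
    case greater
    then have "lookup b i = lookup c i" using j(2) by blast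
    then show ?thesis using greater i(1) by (simp add: max_def)
  qed
  moreover have "\<forall>k>max i j. lookup a k = lookup c k" using i(2) j(2) by simp
  ultimately have "\<exists>i. lookup a i < lookup c i \<and> (\<forall>k>i. lookup a k = lookup c k)" by blast
  then show ?thesis using True by (simp add: degrevlex_gt_def)
qed (use assms in \<open>auto simp: degrevlex_gt_def\<close>)

lemma degrevlex_gt_asym: "degrevlex_gt a b \<Longrightarrow> \<not> degrevlex_gt b a"
  using degrevlex_gt_trans[of a b a] degrevlex_gt_irrefl[of a] by argo

lemma degrevlex_gt_total:
  assumes "a \<noteq> b"
  shows "degrevlex_gt a b \<or> degrevlex_gt b a"
proof -
  let ?D = "{k. lookup a k \<noteq> lookup b k}"
  have fin: "finite ?D"
    by (rule finite_subset[of _ "keys a \<union> keys b"]) (auto simp: in_keys_iff)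
  have ne: "?D \<noteq> {}"
  proof
    assume "?D = {}"
    then have "lookup a k = lookup b k" for k by blast
    then show False using assms poly_mapping_eqI by blast
  qed
  define i where "i = Max ?D"
  have i: "lookup a i \<noteq> lookup b i" using Max_in[OF fin ne] by (simp add: i_def)
  have above: "lookup a k = lookup b k" if "k > i" for k
  proof (rule ccontr)
    assume "lookup a k \<noteq> lookup b k"
    then have "k \<le> i" using Max_ge[OF fin, of k] by (simp add: i_def)
    with that show False by simp
  qed
  consider "total_degree a > total_degree b" | "total_degree b > total_degree a"
    | "total_degree a = total_degree b" "lookup a i < lookup b i"
    | "total_degree a = total_degree b" "lookup b i < lookup a i"
    using i by linarith
  then show ?thesis
  proof cases
    case 3
    have "degrevlex_gt a b"
      unfolding degrevlex_gt_def by (intro disjI2 conjI exI[of _ i]) (use 3 above in simp_all)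
    then show ?thesis ..
  next
    case 4
    have "degrevlex_gt b a"
      unfolding degrevlex_gt_def by (intro disjI2 conjI exI[of _ i]) (use 4 above in simp_all)
    then show ?thesis ..
  qed (simp_all add: degrevlex_gt_def)
qed

lemma lead_exp_degrevlex:
  assumes "f \<noteq> 0"
  shows "lead_exp degrevlex_gt f \<in> keys f"
    "\<And>m. m \<in> keys f \<Longrightarrow> m \<noteq> lead_exp degrevlex_gt f \<Longrightarrow> degrevlex_gt (lead_exp degrevlex_gt f) m"
proof -
  have ne: "keys f \<noteq> {}"
    using assms poly_mapping_eq_sum_single[of f] by force
  have "\<exists>m\<in>keys f. \<forall>m'\<in>keys f. m' \<noteq> m \<longrightarrow> \<not> degrevlex_gt m' m"
    by (rule Finite_Set.bex_max_element[where R = "\<lambda>a b. degrevlex_gt b a"])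
      (use ne in \<open>auto simp: asymp_on_def transp_on_def dest: degrevlex_gt_asym intro: degrevlex_gt_trans\<close>)
  then obtain m where m: "m \<in> keys f" "\<forall>m'\<in>keys f. m' \<noteq> m \<longrightarrow> degrevlex_gt m m'"
    using degrevlex_gt_total by blast
  have "\<exists>!m. m \<in> keys f \<and> (\<forall>m'\<in>keys f. m' \<noteq> m \<longrightarrow> degrevlex_gt m m')"
  proof (rule ex1I[of _ m])
    fix m'
    assume m': "m' \<in> keys f \<and> (\<forall>m''\<in>keys f. m'' \<noteq> m' \<longrightarrow> degrevlex_gt m' m'')"
    show "m' = m"
    proof (rule ccontr)
      assume "m' \<noteq> m"
      then have "degrevlex_gt m' m" "degrevlex_gt m m'" using m m' by auto
      then show False by (simp add: degrevlex_gt_asym)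
    qed
  qed (use m in blast)
  from theI'[OF this]
  show "lead_exp degrevlex_gt f \<in> keys f"
    "\<And>m. m \<in> keys f \<Longrightarrow> m \<noteq> lead_exp degrevlex_gt f \<Longrightarrow> degrevlex_gt (lead_exp degrevlex_gt f) m"
    by (auto simp: lead_exp_def)
qed

lemma lead_term_binomial:
  assumes "degrevlex_gt a b"
  shows "single a (1::real) - single b 1 \<noteq> 0"
    "lead_exp degrevlex_gt (single a 1 - single b 1) = a"
    "lead_term degrevlex_gt (single a 1 - single b 1) = single a 1"
proof -
  let ?f = "single a (1::real) - single b 1"
  have ab: "a \<noteq> b" using assms degrevlex_gt_irrefl by blast
  have lk: "lookup ?f m = (if m = a then 1 else if m = b then -1 else 0)" for m
    using ab by (auto simp: lookup_minus lookup_single when_def)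
  show ne: "?f \<noteq> 0" using lk[of a] by auto
  have keys: "keys ?f = {a, b}" by (auto simp: in_keys_iff lk split: if_splits)
  show le: "lead_exp degrevlex_gt ?f = a"
  proof (rule ccontr)
    assume na: "lead_exp degrevlex_gt ?f \<noteq> a"
    then have "lead_exp degrevlex_gt ?f = b" using lead_exp_degrevlex(1)[OF ne] keys by auto
    moreover have "degrevlex_gt (lead_exp degrevlex_gt ?f) a"
      using lead_exp_degrevlex(2)[OF ne, of a] na keys by auto
    ultimately show False using degrevlex_gt_asym[OF assms] by simp
  qed
  show "lead_term degrevlex_gt ?f = single a 1"
    unfolding lead_term_def le lk by simp
qed

section \<open>The Groebner basis\<close>

context balanced_staged_tree
begin

lemma poly_subst_path_monomial:
  "poly_subst (path_monomial T) f = (\<Sum>m\<in>keys f. single (exp_map rexp m) (lookup f m))"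
  by (rule poly_subst_monomials) (rule path_monomial_eq)

lemma binomial_in_ker_phi:
  assumes "keys a \<subseteq> {1..num_leaves T}" "keys b \<subseteq> {1..num_leaves T}" "exp_map rexp a = exp_map rexp b"
  shows "single a 1 - single b 1 \<in> ker_phi T"
proof (rule subst_eq_zero_imp_ker_phi)
  show "single a 1 - single b 1 \<in> carrier (source_ring T)"
    unfolding diff_conv_add_uminus
    by (intro add_in_carrier uminus_in_carrier single_in_carrier assms)
  have "poly_subst (path_monomial T) (single a 1 - single b 1) =
      (\<Sum>m\<in>{a, b}. single (exp_map rexp m) (lookup (single a 1 - single b 1) m))"
    by (rule poly_subst_monomials_superset[OF path_monomial_eq])
      (auto simp: in_keys_iff lookup_minus lookup_single when_def split: if_splits)
  also have "\<dots> = 0"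
    using assms(3) by (cases "a = b") (auto simp: lookup_minus lookup_single single_uminus)
  finally show "poly_subst (path_monomial T) (single a 1 - single b 1) = 0" .
qed

lemma total_degree_exp_map:
  assumes "keys m \<subseteq> {1..num_leaves T}"
  shows "total_degree (exp_map rexp m) = total_degree m * tree_depth T"
proof -
  have "total_degree (exp_map rexp m) = (\<Sum>x\<in>keys m. lookup m x * total_degree (rexp x))"
    by (simp add: exp_map_def)
  also have "\<dots> = (\<Sum>x\<in>keys m. lookup m x * tree_depth T)"
    by (rule sum.cong) (use assms total_degree_leaf_exp leaf_in_leaves in auto)
  finally show ?thesis by (simp add: total_degree_def sum_distrib_right)
qed

text \<open>The coefficients of \<open>f\<close> at the monomials with a given image sum to zero, so no monomial of \<open>f\<close> is
  alone with its image.\<close>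

lemma ker_phi_collision:
  assumes "verts T \<noteq> {[]}" "f \<in> ker_phi T" "m \<in> keys f"
  obtains m' where "m' \<in> keys f" "m' \<noteq> m" "exp_map rexp m' = exp_map rexp m"
proof -
  have "\<exists>m'\<in>keys f. m' \<noteq> m \<and> exp_map rexp m' = exp_map rexp m"
  proof (rule ccontr)
    assume contra: "\<not> ?thesis"
    have "0 = lookup (poly_subst (path_monomial T) f) (exp_map rexp m)"
      using ker_phi_imp_subst_eq_zero(2)[OF assms(2,1)] by simp
    also have "\<dots> = (\<Sum>m'\<in>keys f. if m' = m then lookup f m else 0)"
      unfolding poly_subst_path_monomial lookup_sum
      by (rule sum.cong) (use contra in \<open>auto simp: lookup_single when_def\<close>)
    also have "\<dots> = lookup f m" using assms(3) by simp
    finally show False using assms(3) by (simp add: in_keys_iff)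
  qed
  then show ?thesis using that by blast
qed

text \<open>The leading monomial of \<open>f\<close> shares its image with a smaller monomial of \<open>f\<close>. Both have the same
  degree because all leaf monomials have degree \<open>d > 0\<close>. After cancelling common factors, the
  bottommost leaf in the two lies in the smaller one, as the order is reverse lexicographic.\<close>

lemma lead_exp_ker_phi_divisible:
  assumes nontrivial: "verts T \<noteq> {[]}" and f: "f \<in> ker_phi T" "f \<noteq> 0"
  obtains a b where "single a 1 - single b 1 \<in> linear_binomials T \<union> quadratic_binomials T"
    "degrevlex_gt a b" "\<And>x. lookup a x \<le> lookup (lead_exp degrevlex_gt f) x"
proof -
  let ?R = "{1..num_leaves T}"
  define m where "m = lead_exp degrevlex_gt f"
  have m: "m \<in> keys f" using lead_exp_degrevlex(1)[OF f(2)] by (simp add: m_def)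
  obtain m' where m': "m' \<in> keys f" "m' \<noteq> m" "exp_map rexp m' = exp_map rexp m"
    using ker_phi_collision[OF nontrivial f(1) m] by blast
  have R: "keys m \<subseteq> ?R" "keys m' \<subseteq> ?R"
    using ker_phi_imp_subst_eq_zero(1)[OF f(1) nontrivial] m m' by (auto simp: carrier_poly_ring)
  have "total_degree m * tree_depth T = total_degree m' * tree_depth T"
    using total_degree_exp_map R m'(3) by metis
  then have "total_degree m = total_degree m'"
    using tree_depth_pos[OF nontrivial] by simp
  moreover have "degrevlex_gt m m'"
    using lead_exp_degrevlex(2)[OF f(2)] m' by (simp add: m_def)
  ultimately obtain l where l: "lookup m l < lookup m' l" "\<forall>k>l. lookup m k = lookup m' k"
    by (auto simp: degrevlex_gt_def)
  \<comment> \<open>Truncated subtraction cancels the greatest common divisor of the two monomials.\<close>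
  define a where "a r = lookup m r - lookup m' r" for r
  define b where "b r = lookup m' r - lookup m r" for r
  have lR: "l \<in> ?R" using l(1) R(2) by (auto simp: in_keys_iff subset_iff)
  have bl: "b l > 0" using l by (simp add: b_def)
  have above: "\<forall>r\<in>{l..num_leaves T}. a r = 0"
  proof
    fix r assume "r \<in> {l..num_leaves T}"
    then show "a r = 0" using l by (cases "l = r") (auto simp: a_def)
  qed
  have same: "(\<Sum>r\<in>?R. a r * lookup (rexp r) y) = (\<Sum>r\<in>?R. b r * lookup (rexp r) y)" for y
  proof -
    have "(\<Sum>r\<in>?R. a r * lookup (rexp r) y) + lookup (exp_map rexp m') y
        = (\<Sum>r\<in>?R. (a r + lookup m' r) * lookup (rexp r) y)"
      by (simp add: lookup_exp_map[OF _ R(2)] sum.distrib distrib_right)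
    also have "\<dots> = (\<Sum>r\<in>?R. (b r + lookup m r) * lookup (rexp r) y)"
      by (rule sum.cong) (auto simp: a_def b_def)
    also have "\<dots> = (\<Sum>r\<in>?R. b r * lookup (rexp r) y) + lookup (exp_map rexp m) y"
      by (simp add: lookup_exp_map[OF _ R(1)] sum.distrib distrib_right)
    finally show ?thesis using m'(3) by simp
  qed
  have a_le: "a x \<le> lookup m x" for x by (simp add: a_def)
  from bottom_leaf_reduction[OF nontrivial same lR bl above] show ?thesis
  proof (elim disjE bexE conjE exE)
    fix r s assume rs: "r \<in> ?R" "s \<in> ?R" "r < s" "a r > 0" "rexp r = rexp s"
    let ?g = "single (single r 1) (1::real) - single (single s 1) 1"
    have gt: "degrevlex_gt (single r 1) (single s 1)"
      by (rule degrevlex_gt_eq_degreeI[of _ _ s]) (use rs(3) in \<open>auto simp: lookup_single\<close>)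
    have "?g \<in> ker_phi T"
      by (rule binomial_in_ker_phi) (use rs in \<open>auto simp: exp_map_single simp del: One_nat_def\<close>)
    moreover have "?g = mvar r - mvar s" by (simp add: mvar_def)
    ultimately have "?g \<in> linear_binomials T"
      using rs lead_term_binomial(1)[OF gt] unfolding linear_binomials_def by blast
    moreover have "lookup (single r 1) x \<le> lookup m x" for x
      using rs(4) a_le[of r] by (auto simp: lookup_single when_def)
    ultimately show ?thesis using that gt by (auto simp: m_def)
  next
    fix r1 r2 s1 s2 u v i j
    assume R4: "r1 \<in> ?R" "r2 \<in> ?R" "s1 \<in> ?R" "s2 \<in> ?R"
      and less: "r1 < s1" "r2 < s1"
      and exp: "rexp r1 + rexp r2 = rexp s1 + rexp s2"
      and dvd: "\<forall>x. lookup (single r1 1 + single r2 (1::nat)) x \<le> a x"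
      and paths: "(u, v) \<in> stage T" "prefix (u @ [i]) (leaf T r1)" "prefix (v @ [j]) (leaf T r2)"
        "prefix (u @ [j]) (leaf T s1)" "prefix (v @ [i]) (leaf T s2)"
    let ?a = "single r1 1 + single r2 (1::nat)" and ?b = "single s1 1 + single s2 (1::nat)"
    let ?g = "single ?a (1::real) - single ?b 1"
    have gt: "degrevlex_gt ?a ?b"
      by (rule degrevlex_gt_eq_degreeI[of _ _ s1]) (use less in \<open>auto simp: lookup_add lookup_single\<close>)
    have "?g \<in> ker_phi T"
    proof (rule binomial_in_ker_phi)
      show "keys ?a \<subseteq> ?R" "keys ?b \<subseteq> ?R" by (intro keys_add_mono; use R4 in simp)+
      show "exp_map rexp ?a = exp_map rexp ?b"
        using exp by (simp add: exp_map_add exp_map_single del: One_nat_def)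
    qed
    moreover have "?g = mvar r1 * mvar r2 - mvar s1 * mvar s2" by (simp add: mvar_def mult_single)
    ultimately have "?g \<in> quadratic_binomials T"
      using R4 paths lead_term_binomial(1)[OF gt] unfolding quadratic_binomials_def by blast
    moreover have "lookup ?a x \<le> lookup m x" for x
      using dvd a_le[of x] le_trans by blast
    ultimately show ?thesis using that gt by (auto simp: m_def)
  qed
qed

lemma finite_binomials: "finite (linear_binomials T \<union> quadratic_binomials T)"
proof -
  let ?R = "{1..num_leaves T}"
  have "linear_binomials T \<subseteq> (\<lambda>(r, s). mvar r - mvar s) ` (?R \<times> ?R)"
    unfolding linear_binomials_def by auto
  moreover have "quadratic_binomials T \<subseteq>
      (\<lambda>(r1, r2, s1, s2). mvar r1 * mvar r2 - mvar s1 * mvar s2) ` (?R \<times> ?R \<times> ?R \<times> ?R)"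
  proof
    fix f assume "f \<in> quadratic_binomials T"
    then obtain r1 r2 s1 s2 where "r1 \<in> ?R" "r2 \<in> ?R" "s1 \<in> ?R" "s2 \<in> ?R"
      "f = mvar r1 * mvar r2 - mvar s1 * mvar s2"
      unfolding quadratic_binomials_def by blast
    then show "f \<in> (\<lambda>(r1, r2, s1, s2). mvar r1 * mvar r2 - mvar s1 * mvar s2) ` (?R \<times> ?R \<times> ?R \<times> ?R)"
      by (intro image_eqI[of _ _ "(r1, r2, s1, s2)"]) auto
  qed
  ultimately have "finite (linear_binomials T)" "finite (quadratic_binomials T)"
    by (auto elim!: finite_subset)
  then show ?thesis by simp
qed

lemma binomials_subset_ker_phi: "linear_binomials T \<union> quadratic_binomials T \<subseteq> ker_phi T"
  by (auto simp: linear_binomials_def quadratic_binomials_def)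

lemma lead_term_in_carrier:
  assumes "verts T \<noteq> {[]}" "f \<in> ker_phi T" "f \<noteq> 0"
  shows "lead_term degrevlex_gt f \<in> carrier (source_ring T)"
  unfolding lead_term_def
  by (rule single_in_carrier)
    (use ker_phi_imp_subst_eq_zero(1)[OF assms(2,1)] lead_exp_degrevlex(1)[OF assms(3)]
      in \<open>auto simp: carrier_poly_ring\<close>)

end

theorem theorem3p5:
  fixes T :: "'l plane_tree"
  assumes "staged_tree T"
    and "verts T \<noteq> {[]}"
    and "balanced T"
  shows "is_groebner_basis {1..num_leaves T} degrevlex_gt (ker_phi T)
    (linear_binomials T \<union> quadratic_binomials T)"
proof -
  interpret balanced_staged_tree T
    using assms by (simp add: balanced_staged_tree_def balanced_staged_tree_axioms_def)
  let ?G = "linear_binomials T \<union> quadratic_binomials T"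
  let ?S = "source_ring T"
  let ?lt = "lead_term degrevlex_gt"
  interpret ring ?S by (rule ring_poly_ring)
  have carr: "?lt ` (ker_phi T - {0}) \<subseteq> carrier ?S"
    using lead_term_in_carrier[OF assms(2)] by auto
  have sub: "?lt ` (?G - {0}) \<subseteq> ?lt ` (ker_phi T - {0})"
    using binomials_subset_ker_phi by blast
  then have carrG: "?lt ` (?G - {0}) \<subseteq> carrier ?S" using carr by blast
  interpret J: ideal "Idl\<^bsub>?S\<^esub> (?lt ` (?G - {0}))" ?S
    by (rule genideal_ideal[OF carrG])
  have "?lt f \<in> Idl\<^bsub>?S\<^esub> (?lt ` (?G - {0}))" if f: "f \<in> ker_phi T" "f \<noteq> 0" for f
  proof -
    let ?m = "lead_exp degrevlex_gt f"
    obtain a b where ab: "single a 1 - single b 1 \<in> ?G" "degrevlex_gt a b" "\<And>x. lookup a x \<le> lookup ?m x"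
      using lead_exp_ker_phi_divisible[OF assms(2) f] by blast
    note lt = lead_term_binomial[OF ab(2)]
    have m: "?m = (?m - a) + a"
      by (rule poly_mapping_eqI) (use ab(3) in \<open>simp add: lookup_add lookup_minus\<close>)
    have "keys ?m \<subseteq> {1..num_leaves T}"
      using ker_phi_imp_subst_eq_zero(1)[OF f(1) assms(2)] lead_exp_degrevlex(1)[OF f(2)]
      by (auto simp: carrier_poly_ring)
    then have q: "keys (?m - a) \<subseteq> {1..num_leaves T}"
      by (auto simp: in_keys_iff lookup_minus subset_iff)
    have "single a 1 \<in> ?lt ` (?G - {0})"
      using ab(1) lt by (metis DiffI image_eqI singletonD)
    then have "single a 1 \<in> Idl\<^bsub>?S\<^esub> (?lt ` (?G - {0}))"
      using genideal_self[OF carrG] by blast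
    from J.I_l_closed[OF this single_in_carrier[OF q, of "lookup f ?m"]]
    show ?thesis
      using m by (simp add: lead_term_def mult_single)
  qed
  then have "Idl\<^bsub>?S\<^esub> (?lt ` (ker_phi T - {0})) \<subseteq> Idl\<^bsub>?S\<^esub> (?lt ` (?G - {0}))"
    by (intro genideal_minimal J.is_ideal) auto
  moreover have "Idl\<^bsub>?S\<^esub> (?lt ` (?G - {0})) \<subseteq> Idl\<^bsub>?S\<^esub> (?lt ` (ker_phi T - {0}))"
    using sub genideal_self[OF carr] by (intro genideal_minimal genideal_ideal[OF carr]) auto
  ultimately show ?thesis
    unfolding is_groebner_basis_def initial_ideal_def
    using finite_binomials binomials_subset_ker_phi by blast
qed

end
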